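(* Let $\mathbf{v}_1,\ldots,\mathbf{v}_k\in\mathbb{R}^k$ and $F:\mathbb{R}^{kn}\to\mathbb{R}$, \[ F(\mathbf{w}_1,\ldots,\mathbf{w}_n)=\mathbb{E}_{\mathbf{x}\sim\mathcal{N}(\mathbf{0},I_k)}\left[\frac{1}{2}\left(\sum_{i=1}^{n}[\mathbf{w}_i^\top\mathbf{x}]_+-\sum_{j=1}^{k}[\mathbf{v}_j^\top\mathbf{x}]_+\right)^2\right]. \] Let $(\mathbf{w}_1,\ldots,\mathbf{w}_n)$ be a point with all $\mathbf{w}_i$ and all $\mathbf{v}_j$ nonzero, $\theta_{\mathbf{w}_i,\mathbf{w}_j}\in(0,\pi)$ for $i\ne j$, and $\theta_{\mathbf{w}_i,\mathbf{v}_j}\in(0,\pi)$ for all $i,j$. Then the Hessian of $F$ at this point, written in $k\times k$ blocks, has diagonal blocks \[ \frac{\partial^2F}{\partial\mathbf{w}_i^2}=\frac{1}{2}I+\sum_{j\ne i}h_1(\mathbf{w}_i,\mathbf{w}_j)-\sum_{j=1}^k h_1(\mathbf{w}_i,\mathbf{v}_j), \] and off-diagonal blocks $\frac{\partial^2F}{\partial\mathbf{w}_i\partial\mathbf{w}_j}=h_2(\mathbf{w}_i,\mathbf{w}_j)$ for $i\ne j$, where \[ h_1(\mathbf{w},\mathbf{v})=\frac{\sin(\theta_{\mathbf{w},\mathbf{v}})\|\mathbf{v}\|}{2\pi\|\mathbf{w}\|}\left(I-\bar{\mathbf{w}}\bar{\mathbf{w}}^\top+\bar{\mathbf{n}}_{\mathbf{v},\mathbf{w}}\bar{\mathbf{n}}_{\mathbf{v},\mathbf{w}}^\top\right),\qquad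 h_2(\mathbf{w},\mathbf{v})=\frac{1}{2\pi}\left((\pi-\theta_{\mathbf{w},\mathbf{v}})I+\bar{\mathbf{n}}_{\mathbf{w},\mathbf{v}}\bar{\mathbf{v}}^\top+\bar{\mathbf{n}}_{\mathbf{v},\mathbf{w}}\bar{\mathbf{w}}^\top\right). \]
   Context: $[z]_+=\max\{0,z\}$; norms are Euclidean. For a nonzero vector $\mathbf{w}$, $\bar{\mathbf{w}}=\mathbf{w}/\|\mathbf{w}\|$. For nonzero $\mathbf{w},\mathbf{v}$, $\theta_{\mathbf{w},\mathbf{v}}=\arccos\left(\frac{\mathbf{w}^\top\mathbf{v}}{\|\mathbf{w}\|\|\mathbf{v}\|}\right)$, and when $\theta_{\mathbf{w},\mathbf{v}}\in(0,\pi)$, $\mathbf{n}_{\mathbf{v},\mathbf{w}}=\bar{\mathbf{v}}-\cos(\theta_{\mathbf{v},\mathbf{w}})\bar{\mathbf{w}}$ and $\bar{\mathbf{n}}_{\mathbf{v},\mathbf{w}}=\mathbf{n}_{\mathbf{v},\mathbf{w}}/\|\mathbf{n}_{\mathbf{v},\mathbf{w}}\|$. *)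

theory Defs
  imports "HOL-Analysis.Analysis"
begin

definition std_gauss :: "(real^'k) measure" where
  "std_gauss = density lborel
     (\<lambda>x. ennreal ((2 * pi) powr (- real CARD('k) / 2) * exp (- (norm x)\<^sup>2 / 2)))"

definition relu :: "real \<Rightarrow> real" where
  "relu z = max 0 z"

definition lossF :: "('k \<Rightarrow> real^'k) \<Rightarrow> real^'k^'n \<Rightarrow> real" where
  "lossF V W = (\<integral>x. (1/2) * ((\<Sum>i\<in>UNIV. relu (W$i \<bullet> x)) - (\<Sum>j\<in>UNIV. relu (V j \<bullet> x)))\<^sup>2 \<partial>std_gauss)"

definition vangle :: "'a::real_inner \<Rightarrow> 'a \<Rightarrow> real" where
  "vangle w v = arccos ((w \<bullet> v) / (norm w * norm v))"

definition nvec :: "'a::real_inner \<Rightarrow> 'a \<Rightarrow> 'a" where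
  "nvec v w = sgn v - cos (vangle v w) *\<^sub>R sgn w"

definition nbar :: "'a::real_inner \<Rightarrow> 'a \<Rightarrow> 'a" where
  "nbar v w = sgn (nvec v w)"

definition outer :: "real^'k \<Rightarrow> real^'k \<Rightarrow> real^'k^'k" where
  "outer u v = (\<chi> a b. u$a * v$b)"

definition h1 :: "real^'k \<Rightarrow> real^'k \<Rightarrow> real^'k^'k" where
  "h1 w v = (sin (vangle w v) * norm v / (2 * pi * norm w)) *\<^sub>R
     (mat 1 - outer (sgn w) (sgn w) + outer (nbar v w) (nbar v w))"

definition h2 :: "real^'k \<Rightarrow> real^'k \<Rightarrow> real^'k^'k" where
  "h2 w v = (1 / (2 * pi)) *\<^sub>R
     ((pi - vangle w v) *\<^sub>R mat 1 + outer (nbar w v) (sgn v) + outer (nbar v w) (sgn w))"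

definition hess_block :: "('k \<Rightarrow> real^'k) \<Rightarrow> real^'k^'n \<Rightarrow> 'n \<Rightarrow> 'n \<Rightarrow> real^'k^'k" where
  "hess_block V W i j =
     (if i = j then (1/2) *\<^sub>R mat 1 + (\<Sum>l\<in>UNIV - {i}. h1 (W$i) (W$l)) - (\<Sum>l\<in>UNIV. h1 (W$i) (V l))
      else h2 (W$i) (W$j))"

end

theory Submission
  imports Defs "HOL-Probability.Distributions" "HOL-Real_Asymp.Real_Asymp"
begin

text \<open>
  Rotation invariance of the Gaussian reduces \<open>E [w\<^sup>T x]\<^sub>+ [v\<^sup>T x]\<^sub>+\<close> to a planar integral, which in the
  coordinates \<open>(y, t) = (y, z / y)\<close> evaluates to \<open>\<parallel>w\<parallel> \<parallel>v\<parallel> (sin \<theta> + (\<pi> - \<theta>) cos \<theta>) / 2\<pi>\<close>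
  when \<open>w\<close> and \<open>v\<close> are not collinear. Near the given point the loss is therefore an explicit smooth
  function, up to the constant contributed by the pairs of target vectors. Its first two derivatives
  follow by the chain rule when \<open>\<parallel>w\<parallel> \<parallel>v\<parallel> sin \<theta>\<close> is written as the square root of the Gram determinant.
\<close>

text \<open>The obstacle is the kink of \<open>relu\<close>: its second derivative is a point mass,
  so differentiating twice under the expectation would bring in Gaussian integrals over hyperplanes.
  Evaluating the expectation first leaves only calculus of finitely many variables. Two kinds of
  pairs escape the planar formula. A weight paired with itself has angle 0, where
  \<open>arccos\<close> is not differentiable; its second moment is computed separately and gives
  the summand I/2 of the diagonal blocks. Two targets may be collinear, since nothing is assumed
  about their angle; their contribution does not depend on the weights, so integrability suffices.
  Integrability matters throughout, because the Bochner integral in \<open>lossF\<close> is 0 by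
  convention for a non-integrable function and is additive only on integrable ones. The matrices
  \<open>h1\<close> and \<open>h2\<close> arise as the partial Jacobians, in the first and in the
  second argument, of the gradient of one two-vector kernel.\<close>

section \<open>Invariance of Lebesgue measure under orthogonal maps\<close>

lemma nn_integral_lborel_translate:
  fixes c :: "'a::euclidean_space"
  assumes [measurable]: "h \<in> borel_measurable borel"
  shows "(\<integral>\<^sup>+x. h (c + x) \<partial>lborel) = (\<integral>\<^sup>+x. h x \<partial>lborel)"
proof -
  have "(\<integral>\<^sup>+x. h x \<partial>lborel) = (\<integral>\<^sup>+x. h x \<partial>distr lborel borel ((+) c))"
    by (simp add: lborel_distr_plus)
  then show ?thesis by (simp add: nn_integral_distr)
qed

lemma nn_integral_lborel_reflect:
  fixes c :: "'a::euclidean_space"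
  assumes [measurable]: "h \<in> borel_measurable borel"
  shows "(\<integral>\<^sup>+x. h (c - x) \<partial>lborel) = (\<integral>\<^sup>+x. h x \<partial>lborel)"
proof -
  have "(\<integral>\<^sup>+x. h x \<partial>lborel) =
      (\<integral>\<^sup>+x. h x \<partial>density (distr lborel borel (\<lambda>x. c + (-1) *\<^sub>R x)) (\<lambda>_. ennreal (\<bar>-1\<bar>^DIM('a))))"
    by (subst lborel_affine[of "-1" c]) simp_all
  then show ?thesis by (simp add: nn_integral_distr density_1)
qed

text \<open>Fubini applied to \<open>1\<^sub>A (f x + y) 1\<^sub>B (y)\<close> for the unit ball \<open>B\<close> shows that the
  translation-invariant image measure agrees with \<open>lborel\<close>, because \<open>f\<close> preserves \<open>B\<close>.\<close>

lemma distr_lborel_orthogonal_transformation: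
  fixes f :: "'a::euclidean_space \<Rightarrow> 'a"
  assumes f: "orthogonal_transformation f"
  shows "distr lborel borel f = lborel"
proof (rule measure_eqI)
  show "sets (distr lborel borel f) = sets lborel" by simp
  fix A assume "A \<in> sets (distr lborel borel f)"
  then have A[measurable]: "A \<in> sets borel" by simp
  have lin: "linear f" using f by (rule orthogonal_transformation_linear)
  have [measurable]: "f \<in> borel_measurable borel"
    using lin by (intro borel_measurable_continuous_onI linear_continuous_on linear_conv_bounded_linear[THEN iffD1])
  define B where "B = ball (0::'a) 1"
  have B[measurable]: "B \<in> sets borel" by (simp add: B_def)
  \<comment> \<open>Writing each \<open>y\<close> as \<open>f y'\<close> turns a translation after
    \<open>f\<close> into a translation before \<open>f\<close>, where invariance of
    \<open>lborel\<close> applies.\<close>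
  have surj: "\<exists>y'. f y' = y" for y
    using orthogonal_transformation_surj[OF f] by (metis surjD)
  have fB: "f x \<in> B \<longleftrightarrow> x \<in> B" for x
    using f by (simp add: B_def orthogonal_transformation_norm)
  have inner1: "(\<integral>\<^sup>+x. indicator A (f x + y) \<partial>lborel) = emeasure (distr lborel borel f) A" for y
  proof -
    obtain y' where y': "f y' = y" using surj by blast
    have "(\<integral>\<^sup>+x. indicator A (f x + y) \<partial>lborel) = (\<integral>\<^sup>+x. indicator A (f (y' + x)) \<partial>lborel)"
      by (simp add: linear_add[OF lin] y' add.commute)
    also have "\<dots> = (\<integral>\<^sup>+x. indicator A (f x) \<partial>lborel)"
      by (rule nn_integral_lborel_translate) measurable
    also have "\<dots> = (\<integral>\<^sup>+x. indicator A x \<partial>distr lborel borel f)"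
      by (simp add: nn_integral_distr del: nn_integral_indicator)
    finally show ?thesis by simp
  qed
  have inner2: "(\<integral>\<^sup>+x. indicator B (y - f x) \<partial>lborel) = emeasure lborel B" for y
  proof -
    obtain y' where y': "f y' = y" using surj by blast
    have "(\<integral>\<^sup>+x. indicator B (y - f x) \<partial>lborel) = (\<integral>\<^sup>+x. indicator B (y' - x) \<partial>lborel)"
    proof (rule nn_integral_cong)
      fix x :: 'a
      have "y - f x = f (y' - x)" by (simp add: linear_diff[OF lin] y')
      then show "(indicator B (y - f x) :: ennreal) = indicator B (y' - x)"
        by (simp add: indicator_def fB)
    qed
    also have "\<dots> = (\<integral>\<^sup>+x. indicator B x \<partial>lborel)"
      by (rule nn_integral_lborel_reflect) measurable
    finally show ?thesis by simp
  qed
  have "emeasure lborel B * emeasure (distr lborel borel f) A =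
      (\<integral>\<^sup>+y. (\<integral>\<^sup>+x. indicator A (f x + y) * indicator B y \<partial>lborel) \<partial>lborel)"
    by (simp add: nn_integral_multc inner1 nn_integral_cmult mult.commute)
  also have "\<dots> = (\<integral>\<^sup>+x. (\<integral>\<^sup>+y. indicator A (f x + y) * indicator B y \<partial>lborel) \<partial>lborel)"
    by (rule lborel_pair.Fubini') measurable
  also have "\<dots> = (\<integral>\<^sup>+x. (\<integral>\<^sup>+y. indicator A y * indicator B (y - f x) \<partial>lborel) \<partial>lborel)"
  proof (rule nn_integral_cong)
    fix x :: 'a
    show "(\<integral>\<^sup>+y. indicator A (f x + y) * indicator B y \<partial>lborel) =
        (\<integral>\<^sup>+y. indicator A y * indicator B (y - f x) \<partial>lborel)"
      using nn_integral_lborel_translate[of "\<lambda>y. indicator A y * indicator B (y - f x)" "f x"]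
      by simp
  qed
  also have "\<dots> = (\<integral>\<^sup>+y. (\<integral>\<^sup>+x. indicator A y * indicator B (y - f x) \<partial>lborel) \<partial>lborel)"
    by (rule lborel_pair.Fubini') measurable
  also have "\<dots> = emeasure lborel B * emeasure lborel A"
    by (simp add: nn_integral_cmult nn_integral_multc inner2 mult.commute)
  finally have "emeasure lborel B * emeasure (distr lborel borel f) A = emeasure lborel B * emeasure lborel A" .
  \<comment> \<open>The ball has positive finite measure, so it can be cancelled in
    \<open>ennreal\<close>.\<close>
  moreover have "emeasure lborel B \<noteq> 0" 
    using open_not_negligible[of B] by (auto simp: B_def negligible_iff_emeasure0)
  moreover have "emeasure lborel B \<noteq> \<infinity>"
    using emeasure_lborel_ball_finite[of "0::'a" 1] by (auto simp: B_def)
  ultimately show "emeasure (distr lborel borel f) A = emeasure lborel A"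
    by (simp add: ennreal_mult_cancel_left)
qed

section \<open>Reflections that move one orthonormal pair to another\<close>

text \<open>For \<open>u = 0\<close> the quotient is 0 by convention and the map is the identity, so
  the case of two equal vectors fits the same construction.\<close>

definition householder :: "'a::real_inner \<Rightarrow> 'a \<Rightarrow> 'a" where
  "householder u x = x - (2 * (x \<bullet> u) / (u \<bullet> u)) *\<^sub>R u"

lemma orthogonal_transformation_householder: "orthogonal_transformation (householder u)"
proof -
  have "linear (householder u)"
    by (rule linearI) (auto simp: householder_def algebra_simps add_divide_distrib)
  moreover have "householder u x \<bullet> householder u y = x \<bullet> y" for x y
  proof (cases "u = 0")
    case False
    then have "u \<bullet> u \<noteq> 0" by simp
    then show ?thesis
      by (simp add: householder_def inner_diff_left inner_diff_right inner_commute[of u y] field_simps)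
  qed (simp add: householder_def)
  ultimately show ?thesis by (simp add: orthogonal_transformation_def)
qed

text \<open>The mirror is the perpendicular bisector of \<open>p\<close> and \<open>q\<close>. Equal
  norms give 2 p.(p - q) = |p - q|^2, so exactly one copy of p - q is subtracted from
  \<open>p\<close>.\<close>

lemma householder_swap:
  assumes "norm p = norm q"
  shows "householder (p - q) p = q"
proof (cases "p = q")
  case False
  have "2 * (p \<bullet> (p - q)) = (p - q) \<bullet> (p - q)"
    using assms by (simp add: inner_diff_left inner_diff_right inner_commute norm_eq)
  then show ?thesis using False by (simp add: householder_def)
qed (simp add: householder_def)

lemma householder_fix: "x \<bullet> u = 0 \<Longrightarrow> householder u x = x"
  by (simp add: householder_def)

text \<open>Two reflections suffice: the first sends \<open>a\<close> to \<open>i\<close>, the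
  second corrects the image of \<open>b\<close>. The axis of the second is a difference of vectors
  orthogonal to \<open>i\<close>, so it leaves \<open>i\<close> in place.\<close>

lemma orthonormal_pair_orthogonal_transformation:
  fixes a b i j :: "'a::euclidean_space"
  assumes "norm a = 1" "norm b = 1" "a \<bullet> b = 0" "norm i = 1" "norm j = 1" "i \<bullet> j = 0"
  obtains f where "orthogonal_transformation f" "f a = i" "f b = j"
proof -
  define g where "g = householder (a - i)"
  have g: "orthogonal_transformation g" and ga: "g a = i"
    using assms by (auto simp: g_def orthogonal_transformation_householder householder_swap)
  define h where "h = householder (g b - j)"
  have h: "orthogonal_transformation h" by (simp add: h_def orthogonal_transformation_householder)
  have "g b \<bullet> i = 0"
    using g assms(3) unfolding ga[symmetric] by (simp add: orthogonal_transformation_def inner_commute)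
  then have "h i = i"
    using assms(6) by (simp add: h_def householder_fix inner_diff_right inner_commute)
  moreover have "h (g b) = j"
    unfolding h_def using assms by (intro householder_swap) (simp add: orthogonal_transformation_norm[OF g])
  ultimately show thesis
    using that[of "h \<circ> g"] orthogonal_transformation_compose[OF h g] ga by simp
qed

section \<open>Reduction of Gaussian expectations to the plane\<close>

text \<open>The two forms of the density serve different ends: the radial one shows rotation
  invariance, the product one lets coordinates be integrated separately.\<close>

lemma std_gauss_eq_prod:
  "(std_gauss :: (real^'k) measure) =
    density lborel (\<lambda>x. \<Prod>b\<in>Basis. ennreal (std_normal_density (x \<bullet> b)))"
proof -
  have "(2 * pi) powr (- real CARD('k) / 2) * exp (- (norm x)\<^sup>2 / 2) =
      (\<Prod>b\<in>Basis. std_normal_density (x \<bullet> b))" for x :: "real^'k"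
  proof -
    have "1 / sqrt (2 * pi) = (2 * pi) powr (- (1 / 2))"
      unfolding powr_minus by (subst powr_half_sqrt) (simp_all only: divide_inverse mult_1 zero_le_mult_iff pi_ge_zero, simp)
    then have "(1 / sqrt (2 * pi)) ^ CARD('k) = ((2 * pi) powr (- (1 / 2))) powr real CARD('k)"
      by (subst powr_realpow) (simp_all only: powr_gt_zero, simp)
    also have "\<dots> = (2 * pi) powr (- (1 / 2) * real CARD('k))"
      by (rule powr_powr)
    also have "- (1 / 2) * real CARD('k) = - real CARD('k) / 2"
      by (simp only: times_divide_eq_left mult_minus_left mult_1)
    finally have c: "(2 * pi) powr (- real CARD('k) / 2) = (1 / sqrt (2 * pi)) ^ CARD('k)" ..
    have "- (norm x)\<^sup>2 / 2 = (\<Sum>b\<in>Basis. - (x \<bullet> b)\<^sup>2 / 2)"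
      unfolding power2_norm_eq_inner euclidean_inner[of x x]
      by (simp add: sum_negf sum_divide_distrib power2_eq_square)
    then have "exp (- (norm x)\<^sup>2 / 2) = (\<Prod>b\<in>Basis. exp (- (x \<bullet> b)\<^sup>2 / 2))"
      by (simp only: exp_sum finite_Basis)
    then show ?thesis unfolding c std_normal_density_def prod.distrib prod_constant by simp
  qed
  then show ?thesis unfolding std_gauss_def by (simp add: prod_ennreal)
qed

text \<open>Two coordinates are split off one after the other; each remaining one contributes the
  total mass 1 of \<open>\<phi>\<close>.\<close>

lemma nn_integral_lborel_Basis_pair:
  fixes i j :: "'a::euclidean_space" and G :: "real \<Rightarrow> real \<Rightarrow> ennreal"
  assumes ij: "i \<in> Basis" "j \<in> Basis" "i \<noteq> j"
    and [measurable]: "case_prod G \<in> borel_measurable (borel \<Otimes>\<^sub>M borel)"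
      "\<phi> \<in> borel_measurable borel"
    and \<phi>: "(\<integral>\<^sup>+x. \<phi> x \<partial>lborel) = 1"
  shows "(\<integral>\<^sup>+x. G (x \<bullet> i) (x \<bullet> j) * (\<Prod>b\<in>Basis. \<phi> (x \<bullet> b)) \<partial>lborel) =
    (\<integral>\<^sup>+y. \<integral>\<^sup>+z. G y z * (\<phi> y * \<phi> z) \<partial>lborel \<partial>lborel)"
proof -
  interpret product_sigma_finite "\<lambda>_::'a. lborel :: real measure" ..
  define R where "R = (Basis :: 'a set) - {i, j}"
  have R: "finite R" "i \<notin> insert j R" "j \<notin> R" and Basis: "Basis = insert i (insert j R)"
    using ij by (auto simp: R_def)
  have [measurable]: "(\<lambda>f. f b) \<in> borel_measurable (Pi\<^sub>M I (\<lambda>_::'a. lborel))" if "b \<in> I" for b :: 'a and I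
    using measurable_component_singleton[OF that, of "\<lambda>_. lborel"] by simp
  have "(\<integral>\<^sup>+x. G (x \<bullet> i) (x \<bullet> j) * (\<Prod>b\<in>Basis. \<phi> (x \<bullet> b)) \<partial>lborel) =
      (\<integral>\<^sup>+f. G (f i) (f j) * (\<Prod>b\<in>Basis. \<phi> (f b)) \<partial>Pi\<^sub>M Basis (\<lambda>_::'a. lborel))"
    using ij by (subst lborel_eq, subst nn_integral_distr) simp_all
  also have "\<dots> = (\<integral>\<^sup>+y. \<integral>\<^sup>+z. \<integral>\<^sup>+f. G y z * (\<phi> y * (\<phi> z * (\<Prod>b\<in>R. \<phi> (f b)))) \<partial>Pi\<^sub>M R (\<lambda>_. lborel)
      \<partial>lborel \<partial>lborel)"
  proof -
    have *: "(\<integral>\<^sup>+f. G y (f j) * (\<phi> y * (\<Prod>b\<in>insert j R. \<phi> (f b))) \<partial>Pi\<^sub>M (insert j R) (\<lambda>_. lborel)) =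
        (\<integral>\<^sup>+z. \<integral>\<^sup>+f. G y z * (\<phi> y * (\<phi> z * (\<Prod>b\<in>R. \<phi> (f b)))) \<partial>Pi\<^sub>M R (\<lambda>_. lborel) \<partial>lborel)" for y
    proof -
      have "(\<integral>\<^sup>+f. G y (f j) * (\<phi> y * (\<Prod>b\<in>insert j R. \<phi> (f b))) \<partial>Pi\<^sub>M (insert j R) (\<lambda>_. lborel)) =
        (\<integral>\<^sup>+z. \<integral>\<^sup>+f. G y ((f(j := z)) j) * (\<phi> y * (\<Prod>b\<in>insert j R. \<phi> ((f(j := z)) b)))
          \<partial>Pi\<^sub>M R (\<lambda>_. lborel) \<partial>lborel)"
        by (rule product_nn_integral_insert_rev[OF R(1,3)]) simp
      moreover have "(\<Prod>b\<in>insert j R. \<phi> ((f(j := z)) b)) = \<phi> z * (\<Prod>b\<in>R. \<phi> (f b))" for f z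
        using R by (simp, intro arg_cong2[of _ _ _ _ "(*)"] refl prod.cong) auto
      ultimately show ?thesis by (simp only: fun_upd_same)
    qed
    have "(\<integral>\<^sup>+f. G (f i) (f j) * (\<Prod>b\<in>insert i (insert j R). \<phi> (f b)) \<partial>Pi\<^sub>M (insert i (insert j R)) (\<lambda>_. lborel)) =
        (\<integral>\<^sup>+y. \<integral>\<^sup>+f. G ((f(i := y)) i) ((f(i := y)) j) * (\<Prod>b\<in>insert i (insert j R). \<phi> ((f(i := y)) b))
          \<partial>Pi\<^sub>M (insert j R) (\<lambda>_. lborel) \<partial>lborel)"
      using R(1) by (intro product_nn_integral_insert_rev R(2)) simp_all
    moreover have "(\<Prod>b\<in>insert i (insert j R). \<phi> ((f(i := y)) b)) = \<phi> y * (\<Prod>b\<in>insert j R. \<phi> (f b))" for f y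
      using R by (subst prod.insert) (auto intro!: arg_cong2[of _ _ _ _ "(*)"] prod.cong)
    ultimately show ?thesis
      by (simp only: Basis fun_upd_same fun_upd_other[OF not_sym[OF ij(3)]] *)
  qed
  also have "\<dots> = (\<integral>\<^sup>+y. \<integral>\<^sup>+z. G y z * (\<phi> y * \<phi> z) \<partial>lborel \<partial>lborel)"
  proof -
    have "(\<integral>\<^sup>+f. G y z * (\<phi> y * (\<phi> z * (\<Prod>b\<in>R. \<phi> (f b)))) \<partial>Pi\<^sub>M R (\<lambda>_. lborel)) = G y z * (\<phi> y * \<phi> z)" for y z
    proof -
      have "(\<integral>\<^sup>+f. G y z * (\<phi> y * (\<phi> z * (\<Prod>b\<in>R. \<phi> (f b)))) \<partial>Pi\<^sub>M R (\<lambda>_. lborel)) =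
          G y z * \<phi> y * \<phi> z * (\<integral>\<^sup>+f. (\<Prod>b\<in>R. \<phi> (f b)) \<partial>Pi\<^sub>M R (\<lambda>_. lborel))"
        by (subst nn_integral_cmult[symmetric]) (auto simp: mult.assoc)
      also have "(\<integral>\<^sup>+f. (\<Prod>b\<in>R. \<phi> (f b)) \<partial>Pi\<^sub>M R (\<lambda>_. lborel)) = 1"
        using product_nn_integral_prod[OF R(1), of "\<lambda>_. \<phi>"] by (simp add: \<phi>)
      finally show ?thesis by (simp add: mult.assoc)
    qed
    then show ?thesis by simp
  qed
  finally show ?thesis .
qed

text \<open>The given pair only witnesses that the dimension is at least 2.\<close>

lemma orthonormal_pair_Basis:
  fixes a b :: "'a::euclidean_space"
  assumes "norm a = 1" "norm b = 1" "a \<bullet> b = 0"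
  obtains i j :: 'a where "i \<in> Basis" "j \<in> Basis" "i \<noteq> j"
proof -
  have "a \<noteq> b" using assms by auto
  have "independent {a, b}"
    using assms by (intro pairwise_orthogonal_independent) (auto simp: pairwise_def orthogonal_def inner_commute)
  from independent_bound[OF this] have "2 \<le> card (Basis :: 'a set)" using \<open>a \<noteq> b\<close> by simp
  then obtain T where "T \<subseteq> (Basis :: 'a set)" "card T = 2"
    using obtain_subset_with_card_n by metis
  then show thesis using that by (auto simp: card_2_iff)
qed

lemma nn_integral_std_normal_density: "(\<integral>\<^sup>+x. ennreal (std_normal_density x) \<partial>lborel) = 1"
  by (subst nn_integral_eq_integral) auto

lemma nn_integral_std_gauss_orthonormal_pair:
  fixes a b :: "real^'k" and G :: "real \<Rightarrow> real \<Rightarrow> ennreal"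
  assumes ab: "norm a = 1" "norm b = 1" "a \<bullet> b = 0"
    and [measurable]: "case_prod G \<in> borel_measurable (borel \<Otimes>\<^sub>M borel)"
  shows "(\<integral>\<^sup>+x. G (a \<bullet> x) (b \<bullet> x) \<partial>std_gauss) =
    (\<integral>\<^sup>+y. \<integral>\<^sup>+z. G y z * (ennreal (std_normal_density y) * ennreal (std_normal_density z)) \<partial>lborel \<partial>lborel)"
proof -
  obtain i j :: "real^'k" where ij: "i \<in> Basis" "j \<in> Basis" "i \<noteq> j"
    using orthonormal_pair_Basis[OF ab] .
  have ij': "norm i = 1" "norm j = 1" "i \<bullet> j = 0"
    using ij by (auto simp: inner_Basis)
  obtain f where f: "orthogonal_transformation f" "f i = a" "f j = b"
    using orthonormal_pair_orthogonal_transformation[OF ij' ab] .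
  have [measurable]: "f \<in> borel_measurable borel"
    using orthogonal_transformation_linear[OF f(1)]
    by (intro borel_measurable_continuous_onI linear_continuous_on linear_conv_bounded_linear[THEN iffD1])
  have f_inner: "a \<bullet> f x = i \<bullet> x" "b \<bullet> f x = j \<bullet> x" for x
    using f by (auto simp: orthogonal_transformation_def)
  define c where "c = (2 * pi) powr (- real CARD('k) / 2)"
  have "(\<integral>\<^sup>+x. G (a \<bullet> x) (b \<bullet> x) \<partial>std_gauss) =
      (\<integral>\<^sup>+x. ennreal (c * exp (- (norm x)\<^sup>2 / 2)) * G (a \<bullet> x) (b \<bullet> x) \<partial>lborel)"
    unfolding std_gauss_def c_def by (subst nn_integral_density) simp_all
  \<comment> \<open>Replacing \<open>lborel\<close> by its image under \<open>f\<close> substitutes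
    \<open>f x\<close> for \<open>x\<close>; the density depends on the norm alone and does not
    notice, while \<open>a\<close> and \<open>b\<close> become \<open>i\<close> and
    \<open>j\<close>.\<close>
  also have "\<dots> = (\<integral>\<^sup>+x. ennreal (c * exp (- (norm x)\<^sup>2 / 2)) * G (a \<bullet> x) (b \<bullet> x) \<partial>distr lborel borel f)"
    by (simp only: distr_lborel_orthogonal_transformation[OF f(1)])
  also have "\<dots> = (\<integral>\<^sup>+x. ennreal (c * exp (- (norm x)\<^sup>2 / 2)) * G (i \<bullet> x) (j \<bullet> x) \<partial>lborel)"
    by (subst nn_integral_distr) (simp_all add: orthogonal_transformation_norm[OF f(1)] f_inner)
  also have "\<dots> = (\<integral>\<^sup>+x. G (i \<bullet> x) (j \<bullet> x) \<partial>std_gauss)"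
    unfolding std_gauss_def c_def by (subst nn_integral_density) simp_all
  also have "\<dots> = (\<integral>\<^sup>+x. G (x \<bullet> i) (x \<bullet> j) * (\<Prod>b\<in>Basis. ennreal (std_normal_density (x \<bullet> b))) \<partial>lborel)"
    unfolding std_gauss_eq_prod by (subst nn_integral_density) (simp_all add: inner_commute mult.commute)
  also have "\<dots> = (\<integral>\<^sup>+y. \<integral>\<^sup>+z. G y z * (ennreal (std_normal_density y) * ennreal (std_normal_density z)) \<partial>lborel \<partial>lborel)"
    using ij by (intro nn_integral_lborel_Basis_pair) (simp_all add: nn_integral_std_normal_density)
  finally show ?thesis .
qed

section \<open>The planar integral\<close>

lemma relu_scale: "c \<ge> 0 \<Longrightarrow> relu (c * z) = c * relu z"
  using max_mult_distrib_left[of c 0 z] by (simp add: relu_def)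

lemma relu_nonneg: "0 \<le> relu z"
  by (simp add: relu_def)

lemma borel_measurable_relu [measurable]: "relu \<in> borel_measurable borel"
  unfolding relu_def[abs_def] by measurable

text \<open>This is the radial factor of the planar integral. Of the three powers of
  \<open>y\<close>, two come from the two \<open>relu\<close> factors and one from the Jacobian of z
  = y t.\<close>

lemma nn_integral_cube_exp:
  assumes a: "a > 0"
  shows "(\<integral>\<^sup>+y. ennreal (y ^ 3 * exp (- (a * y\<^sup>2 / 2))) * indicator {0..} y \<partial>lborel) = ennreal (2 / a\<^sup>2)"
proof -
  define F where "F y = - ((y\<^sup>2 / a + 2 / a\<^sup>2) * exp (- (a * y\<^sup>2 / 2)))" for y
  have "(F has_real_derivative y ^ 3 * exp (- (a * y\<^sup>2 / 2))) (at y)" for y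
    unfolding F_def using a
    by (auto intro!: derivative_eq_intros simp: field_simps power2_eq_square power3_eq_cube)
  moreover have "(F \<longlongrightarrow> 0) at_top"
  proof -
    \<comment> \<open>With s = a y^2 / 2 the antiderivative is -(2 / a^2) (s + 1) exp (-s), which
      vanishes at infinity.\<close>
    have lim: "filterlim (\<lambda>y::real. a * y\<^sup>2 / 2) at_top at_top"
      using a by real_asymp
    have "((\<lambda>s::real. - (2 / a\<^sup>2) * (s ^ 1 / exp s + s ^ 0 / exp s)) \<longlongrightarrow> - (2 / a\<^sup>2) * (0 + 0)) at_top"
      by (intro tendsto_intros tendsto_power_div_exp_0)
    moreover have "F = (\<lambda>y. - (2 / a\<^sup>2) * ((a * y\<^sup>2 / 2) ^ 1 / exp (a * y\<^sup>2 / 2) + (a * y\<^sup>2 / 2) ^ 0 / exp (a * y\<^sup>2 / 2)))"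
      using a by (auto simp: fun_eq_iff F_def exp_minus field_simps power2_eq_square)
    ultimately show ?thesis
      using filterlim_compose[OF _ lim] by fastforce
  qed
  ultimately have "(\<integral>\<^sup>+y. ennreal (y ^ 3 * exp (- (a * y\<^sup>2 / 2))) * indicator {0..} y \<partial>lborel) = ennreal (0 - F 0)"
    by (intro nn_integral_FTC_atLeast) auto
  then show ?thesis by (simp add: F_def)
qed

text \<open>The point t = - cot theta is where cos theta + sin theta t changes sign, hence the lower
  limit of the next integral.\<close>

lemma arctan_minus_cot:
  assumes "0 < \<theta>" "\<theta> < pi"
  shows "arctan (- (cos \<theta> / sin \<theta>)) = \<theta> - pi / 2"
proof (rule arctan_unique)
  show "tan (\<theta> - pi / 2) = - (cos \<theta> / sin \<theta>)"
    by (simp add: tan_def sin_diff cos_diff)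
qed (use assms in auto)

text \<open>The weight is the value 2 / a^2 of the radial integral at a = 1 + t^2.\<close>

lemma nn_integral_relu_linear_cauchy_square:
  assumes \<theta>: "0 < \<theta>" "\<theta> < pi"
  shows "(\<integral>\<^sup>+t. ennreal (relu (cos \<theta> + sin \<theta> * t) * (2 / (1 + t\<^sup>2)\<^sup>2)) \<partial>lborel) =
    ennreal (sin \<theta> + (pi - \<theta>) * cos \<theta>)"
proof -
  have s: "sin \<theta> > 0" using \<theta> by (rule sin_gt_zero)
  define c where "c = - (cos \<theta> / sin \<theta>)"
  have c: "c \<le> t \<longleftrightarrow> 0 \<le> cos \<theta> + sin \<theta> * t" for t
    unfolding c_def using s by (auto simp: field_simps)
  \<comment> \<open>The antiderivative of 2 / (1 + t^2)^2 is t / (1 + t^2) + arctan t, and that of 2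
    t / (1 + t^2)^2 is - 1 / (1 + t^2).\<close>
  define F where "F t = cos \<theta> * (t / (1 + t\<^sup>2) + arctan t) - sin \<theta> * (1 / (1 + t\<^sup>2))" for t
  have pos: "1 + t\<^sup>2 \<noteq> 0" for t :: real
    by (smt (verit) zero_le_power2)
  have "(F has_real_derivative (cos \<theta> + sin \<theta> * t) * (2 / (1 + t\<^sup>2)\<^sup>2)) (at t)" for t
  proof -
    have "(F has_real_derivative cos \<theta> * (((1 + t\<^sup>2) - t * (2 * t)) / (1 + t\<^sup>2)\<^sup>2 + inverse (1 + t\<^sup>2))
        - sin \<theta> * (- (2 * t) / (1 + t\<^sup>2)\<^sup>2)) (at t)"
      unfolding F_def
      by (rule derivative_eq_intros refl pos | simp add: power2_eq_square[of "1 + t\<^sup>2"])+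
    moreover have "((1 + t\<^sup>2) - t * (2 * t)) / (1 + t\<^sup>2)\<^sup>2 + inverse (1 + t\<^sup>2) = 2 / (1 + t\<^sup>2)\<^sup>2"
      using pos[of t] by (simp add: divide_simps) (simp add: power2_eq_square algebra_simps)
    moreover have "cos \<theta> * (2 / (1 + t\<^sup>2)\<^sup>2) - sin \<theta> * (- (2 * t) / (1 + t\<^sup>2)\<^sup>2) =
        (cos \<theta> + sin \<theta> * t) * (2 / (1 + t\<^sup>2)\<^sup>2)"
      by (simp add: algebra_simps add_divide_distrib)
    ultimately show ?thesis by (simp only:)
  qed
  moreover have "(F \<longlongrightarrow> cos \<theta> * (0 + pi / 2) - sin \<theta> * 0) at_top"
  proof -
    have "((\<lambda>t::real. t / (1 + t\<^sup>2)) \<longlongrightarrow> 0) at_top" "((\<lambda>t::real. 1 / (1 + t\<^sup>2)) \<longlongrightarrow> 0) at_top"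
      by real_asymp+
    then show ?thesis unfolding F_def by (intro tendsto_intros tendsto_arctan_at_top)
  qed
  ultimately have "(\<integral>\<^sup>+t. ennreal ((cos \<theta> + sin \<theta> * t) * (2 / (1 + t\<^sup>2)\<^sup>2)) * indicator {c..} t \<partial>lborel) =
      ennreal (cos \<theta> * (0 + pi / 2) - sin \<theta> * 0 - F c)"
    by (intro nn_integral_FTC_atLeast) (auto simp: c)
  moreover have "ennreal (relu (cos \<theta> + sin \<theta> * t) * (2 / (1 + t\<^sup>2)\<^sup>2)) =
      ennreal ((cos \<theta> + sin \<theta> * t) * (2 / (1 + t\<^sup>2)\<^sup>2)) * indicator {c..} t" for t
    using c[of t] by (auto simp: relu_def indicator_def)
  moreover have "cos \<theta> * (0 + pi / 2) - sin \<theta> * 0 - F c = sin \<theta> + (pi - \<theta>) * cos \<theta>"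
  proof -
    \<comment> \<open>Since \<open>c\<close> is - cot theta, this is 1 + cot^2 = 1 / sin^2.\<close>
    have "sin \<theta> ^ 2 * (1 + c\<^sup>2) = 1"
      using s by (simp add: c_def power_divide distrib_left)
    then have c2: "1 / (1 + c\<^sup>2) = (sin \<theta>)\<^sup>2"
      using pos[of c] by (simp add: field_simps)
    have "F c = cos \<theta> * (c * (1 / (1 + c\<^sup>2)) + arctan c) - sin \<theta> * (1 / (1 + c\<^sup>2))"
      by (simp add: F_def)
    also have "\<dots> = cos \<theta> * (- (cos \<theta> * sin \<theta>) + (\<theta> - pi / 2)) - sin \<theta> * (sin \<theta>)\<^sup>2"
      unfolding c2 using s arctan_minus_cot[OF \<theta>] by (simp add: c_def power2_eq_square)
    also have "\<dots> = - (sin \<theta> * ((cos \<theta>)\<^sup>2 + (sin \<theta>)\<^sup>2)) + cos \<theta> * (\<theta> - pi / 2)"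
      by algebra
    finally show ?thesis by (simp add: algebra_simps)
  qed
  ultimately show ?thesis by simp
qed

text \<open>The substitution \<open>z = y t\<close> in the inner integral separates the variables.\<close>

lemma nn_integral_relu_relu_std_normal:
  assumes \<theta>: "0 < \<theta>" "\<theta> < pi"
  shows "(\<integral>\<^sup>+y. \<integral>\<^sup>+z. ennreal (relu y * relu (cos \<theta> * y + sin \<theta> * z)) *
      (ennreal (std_normal_density y) * ennreal (std_normal_density z)) \<partial>lborel \<partial>lborel) =
    ennreal ((sin \<theta> + (pi - \<theta>) * cos \<theta>) / (2 * pi))"
proof -
  define q where "q t = relu (cos \<theta> + sin \<theta> * t) / (2 * pi)" for t
  have [measurable]: "q \<in> borel_measurable borel" unfolding q_def by measurable
  have q0: "0 \<le> q t" for t by (simp add: q_def relu_nonneg)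
  define K where "K t y = ennreal (q t) * (ennreal (y ^ 3 * exp (- ((1 + t\<^sup>2) * y\<^sup>2 / 2))) * indicator {0..} y)" for t y :: real
  have "(\<integral>\<^sup>+z. ennreal (relu y * relu (cos \<theta> * y + sin \<theta> * z)) *
      (ennreal (std_normal_density y) * ennreal (std_normal_density z)) \<partial>lborel) = (\<integral>\<^sup>+t. K t y \<partial>lborel)" for y
  proof (cases "y > 0")
    case True
    have "(\<integral>\<^sup>+z. ennreal (relu y * relu (cos \<theta> * y + sin \<theta> * z)) *
        (ennreal (std_normal_density y) * ennreal (std_normal_density z)) \<partial>lborel) =
      ennreal \<bar>y\<bar> * (\<integral>\<^sup>+t. ennreal (relu y * relu (cos \<theta> * y + sin \<theta> * (0 + y * t))) *
        (ennreal (std_normal_density y) * ennreal (std_normal_density (0 + y * t))) \<partial>lborel)"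
      using True by (intro nn_integral_real_affine) auto
    also have "\<dots> = (\<integral>\<^sup>+t. ennreal \<bar>y\<bar> * (ennreal (relu y * relu (cos \<theta> * y + sin \<theta> * (0 + y * t))) *
        (ennreal (std_normal_density y) * ennreal (std_normal_density (0 + y * t)))) \<partial>lborel)"
      by (rule nn_integral_cmult[symmetric]) measurable
    also have "\<dots> = (\<integral>\<^sup>+t. K t y \<partial>lborel)"
    proof (rule nn_integral_cong)
      fix t :: real
      \<comment> \<open>Positive homogeneity of \<open>relu\<close> pulls \<open>y\<close> out of
        the second factor, leaving a function of \<open>t\<close> alone.\<close>
      have r: "relu y = y" "relu (cos \<theta> * y + sin \<theta> * (0 + y * t)) = y * relu (cos \<theta> + sin \<theta> * t)"
        using True max_mult_distrib_left[of y 0 "cos \<theta> + sin \<theta> * t"] by (simp_all add: relu_def algebra_simps)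
      have d: "std_normal_density y * std_normal_density (0 + y * t) =
          exp (- ((1 + t\<^sup>2) * y\<^sup>2 / 2)) / (2 * pi)"
      proof -
        have "std_normal_density y * std_normal_density (0 + y * t) =
            exp (- y\<^sup>2 / 2 + - (y * t)\<^sup>2 / 2) / (sqrt (2 * pi) * sqrt (2 * pi))"
          unfolding std_normal_density_def exp_add by simp
        also have "- y\<^sup>2 / 2 + - (y * t)\<^sup>2 / 2 = - ((1 + t\<^sup>2) * y\<^sup>2 / 2)"
          by (simp add: algebra_simps add_divide_distrib diff_divide_distrib)
        also have "sqrt (2 * pi) * sqrt (2 * pi) = 2 * pi"
          by (rule real_sqrt_mult_self[THEN trans]) (simp add: abs_mult)
        finally show ?thesis .
      qed
      have "y * (y * (y * relu (cos \<theta> + sin \<theta> * t)) * (exp (- ((1 + t\<^sup>2) * y\<^sup>2 / 2)) / (2 * pi))) =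
          q t * (y ^ 3 * exp (- ((1 + t\<^sup>2) * y\<^sup>2 / 2)))"
        by (simp add: q_def power3_eq_cube)
      then show "ennreal \<bar>y\<bar> * (ennreal (relu y * relu (cos \<theta> * y + sin \<theta> * (0 + y * t))) *
        (ennreal (std_normal_density y) * ennreal (std_normal_density (0 + y * t)))) = K t y"
        using True unfolding K_def r d[symmetric]
        by (simp add: ennreal_mult'[symmetric] ennreal_mult''[symmetric] relu_nonneg q0 d)
    qed
    finally show ?thesis .
  next
    case False
    \<comment> \<open>This case includes y = 0, where z = y t is no substitution; there the cube
      makes \<open>K t y\<close> vanish.\<close>
    then have "relu y = 0" "K t y = 0" for t by (auto simp: relu_def K_def indicator_def)
    then show ?thesis by simp
  qed
  then have "(\<integral>\<^sup>+y. \<integral>\<^sup>+z. ennreal (relu y * relu (cos \<theta> * y + sin \<theta> * z)) *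
      (ennreal (std_normal_density y) * ennreal (std_normal_density z)) \<partial>lborel \<partial>lborel) =
    (\<integral>\<^sup>+y. \<integral>\<^sup>+t. K t y \<partial>lborel \<partial>lborel)"
    by simp
  also have "\<dots> = (\<integral>\<^sup>+t. \<integral>\<^sup>+y. K t y \<partial>lborel \<partial>lborel)"
    unfolding K_def by (rule lborel_pair.Fubini') measurable
  also have "\<dots> = (\<integral>\<^sup>+t. ennreal (1 / (2 * pi)) * ennreal (relu (cos \<theta> + sin \<theta> * t) * (2 / (1 + t\<^sup>2)\<^sup>2)) \<partial>lborel)"
  proof (rule nn_integral_cong)
    fix t :: real
    have "1 + t\<^sup>2 > 0" by (smt (verit) zero_le_power2)
    then have "(\<integral>\<^sup>+y. K t y \<partial>lborel) = ennreal (q t) * ennreal (2 / (1 + t\<^sup>2)\<^sup>2)"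
      unfolding K_def by (subst nn_integral_cmult) (simp_all add: nn_integral_cube_exp)
    also have "\<dots> = ennreal (q t * (2 / (1 + t\<^sup>2)\<^sup>2))"
      by (rule ennreal_mult[symmetric]) (simp_all add: q0)
    also have "q t * (2 / (1 + t\<^sup>2)\<^sup>2) = 1 / (2 * pi) * (relu (cos \<theta> + sin \<theta> * t) * (2 / (1 + t\<^sup>2)\<^sup>2))"
      by (simp add: q_def)
    also have "ennreal \<dots> = ennreal (1 / (2 * pi)) * ennreal (relu (cos \<theta> + sin \<theta> * t) * (2 / (1 + t\<^sup>2)\<^sup>2))"
      by (rule ennreal_mult) (simp_all add: relu_nonneg)
    finally show "(\<integral>\<^sup>+y. K t y \<partial>lborel) = \<dots>" .
  qed
  also have "\<dots> = ennreal (1 / (2 * pi)) * ennreal (sin \<theta> + (pi - \<theta>) * cos \<theta>)"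
    by (subst nn_integral_cmult) (measurable, simp only: nn_integral_relu_linear_cauchy_square[OF \<theta>])
  also have "\<dots> = ennreal (1 / (2 * pi) * (sin \<theta> + (pi - \<theta>) * cos \<theta>))"
    by (rule ennreal_mult'[symmetric]) simp
  finally show ?thesis by simp
qed

section \<open>Angles, Gram determinants and normals of noncollinear pairs\<close>

text \<open>Strict Cauchy-Schwarz is a strict inequality between continuous functions, so it cuts
  out an open set, and it already forces both vectors to be nonzero.\<close>

definition noncollinear :: "'a::real_inner \<Rightarrow> 'a \<Rightarrow> bool" where
  "noncollinear w v \<longleftrightarrow> \<bar>w \<bullet> v\<bar> < norm w * norm v"

text \<open>The area of the parallelogram spanned by the two vectors.\<close>

definition gram :: "'a::real_inner \<Rightarrow> 'a \<Rightarrow> real" where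
  "gram w v = sqrt ((w \<bullet> w) * (v \<bullet> v) - (w \<bullet> v)\<^sup>2)"

text \<open>Half of the arc-cosine kernel of order one.\<close>

definition relu_kernel :: "'a::real_inner \<Rightarrow> 'a \<Rightarrow> real" where
  "relu_kernel w v = (gram w v + (pi - vangle w v) * (w \<bullet> v)) / (2 * pi)"

lemma noncollinear_commute: "noncollinear w v \<longleftrightarrow> noncollinear v w"
  by (simp add: noncollinear_def inner_commute mult.commute)

lemma vangle_commute: "vangle w v = vangle v w"
  by (simp add: vangle_def inner_commute mult.commute)

lemma gram_commute: "gram w v = gram v w"
  by (simp add: gram_def inner_commute mult.commute)

lemma noncollinear_nonzero:
  assumes "noncollinear w v"
  shows "w \<noteq> 0" "v \<noteq> 0"
  using assms by (auto simp: noncollinear_def)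

lemma noncollinear_cosine:
  assumes "noncollinear w v"
  shows "\<bar>(w \<bullet> v) / (norm w * norm v)\<bar> < 1"
  using assms noncollinear_nonzero[OF assms] by (simp add: noncollinear_def abs_mult divide_simps)

lemma noncollinearI:
  assumes "w \<noteq> 0" "v \<noteq> 0" "vangle w v \<in> {0<..<pi}"
  shows "noncollinear w v"
proof (rule ccontr)
  assume "\<not> noncollinear w v"
  then have "\<bar>w \<bullet> v\<bar> = norm w * norm v"
    using Cauchy_Schwarz_ineq2[of w v] by (simp add: noncollinear_def)
  then have "(w \<bullet> v) / (norm w * norm v) = 1 \<or> (w \<bullet> v) / (norm w * norm v) = -1"
    using assms(1,2) by (auto simp: abs_if field_simps split: if_splits)
  then show False using assms(3) unfolding vangle_def by (auto simp only: arccos_1 arccos_minus_1 greaterThanLessThan_iff less_irrefl)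
qed

lemma
  assumes "noncollinear w v"
  shows vangle_gt_zero: "0 < vangle w v" and vangle_lt_pi: "vangle w v < pi"
    and cos_vangle: "cos (vangle w v) = (w \<bullet> v) / (norm w * norm v)"
  using noncollinear_cosine[OF assms, unfolded abs_less_iff] arccos_lt_bounded[of "(w \<bullet> v) / (norm w * norm v)"]
  unfolding vangle_def by (simp_all only: cos_arccos less_imp_le minus_less_iff)

lemma gram_pos:
  assumes "noncollinear w v"
  shows "gram w v > 0"
proof -
  have "\<bar>w \<bullet> v\<bar>\<^sup>2 < (norm w * norm v)\<^sup>2"
    using assms unfolding noncollinear_def by (intro power_strict_mono) auto
  then show ?thesis by (simp add: gram_def power_mult_distrib power2_norm_eq_inner)
qed

lemma gram_squared:
  assumes "noncollinear w v"
  shows "(gram w v)\<^sup>2 = (w \<bullet> w) * (v \<bullet> v) - (w \<bullet> v)\<^sup>2"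
  using gram_pos[OF assms] unfolding gram_def by simp

lemma sin_vangle:
  assumes "noncollinear w v"
  shows "sin (vangle w v) = gram w v / (norm w * norm v)"
proof -
  let ?c = "(w \<bullet> v) / (norm w * norm v)"
  note nz = noncollinear_nonzero[OF assms]
  have "sin (vangle w v) = sqrt (1 - ?c\<^sup>2)"
    using noncollinear_cosine[OF assms] unfolding vangle_def by (intro sin_arccos_abs) simp
  also have "1 - ?c\<^sup>2 = ((w \<bullet> w) * (v \<bullet> v) - (w \<bullet> v)\<^sup>2) / (norm w * norm v)\<^sup>2"
    using nz by (simp add: field_simps power2_norm_eq_inner)
  also have "sqrt \<dots> = gram w v / (norm w * norm v)"
    by (simp add: gram_def real_sqrt_divide)
  finally show ?thesis .
qed

text \<open>Removing from a unit vector its component along a unit vector at angle theta leaves a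
  vector of length sin theta.\<close>

lemma nbar_eq:
  assumes "noncollinear w v"
  shows "nbar v w = (1 / sin (vangle w v)) *\<^sub>R (sgn v - cos (vangle w v) *\<^sub>R sgn w)"
proof -
  note nz = noncollinear_nonzero[OF assms]
  let ?\<theta> = "vangle w v"
  have s: "sin ?\<theta> > 0"
    using vangle_gt_zero[OF assms] vangle_lt_pi[OF assms] by (rule sin_gt_zero)
  have "(norm (nvec v w))\<^sup>2 = sgn v \<bullet> sgn v - 2 * cos ?\<theta> * (sgn w \<bullet> sgn v) + (cos ?\<theta>)\<^sup>2 * (sgn w \<bullet> sgn w)"
    unfolding nvec_def power2_norm_eq_inner
    by (simp add: vangle_commute[of v] inner_commute power2_eq_square algebra_simps)
  also have "sgn w \<bullet> sgn v = cos ?\<theta>"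
    by (simp add: cos_vangle[OF assms] sgn_div_norm divide_inverse mult.commute)
  also have "sgn v \<bullet> sgn v = 1"
    using nz by (simp add: norm_sgn flip: power2_norm_eq_inner)
  also have "sgn w \<bullet> sgn w = 1"
    using nz by (simp add: norm_sgn flip: power2_norm_eq_inner)
  also have "1 - 2 * cos ?\<theta> * cos ?\<theta> + (cos ?\<theta>)\<^sup>2 * 1 = (sin ?\<theta>)\<^sup>2"
    unfolding sin_squared_eq by (simp add: power2_eq_square)
  finally have "norm (nvec v w) = sin ?\<theta>"
    using s by simp
  then show ?thesis
    by (simp add: nbar_def sgn_div_norm nvec_def vangle_commute[of v] inverse_eq_divide)
qed

text \<open>These are the planar coordinates for the expectation: \<open>sgn w\<close> and
  \<open>nbar v w\<close> form an orthonormal frame in which \<open>w\<close> lies on the first axis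
  and \<open>v\<close> has polar angle theta.\<close>

lemma nbar_orthonormal:
  assumes "noncollinear w v"
  shows "norm (nbar v w) = 1" "sgn w \<bullet> nbar v w = 0"
    "v = norm v *\<^sub>R (cos (vangle w v) *\<^sub>R sgn w + sin (vangle w v) *\<^sub>R nbar v w)"
proof -
  note nz = noncollinear_nonzero[OF assms]
  have s: "sin (vangle w v) > 0"
    using vangle_gt_zero[OF assms] vangle_lt_pi[OF assms] by (rule sin_gt_zero)
  have w: "sgn w \<bullet> sgn w = 1" "sgn w \<bullet> sgn v = cos (vangle w v)"
    using nz by (simp_all add: norm_sgn cos_vangle[OF assms] flip: power2_norm_eq_inner)
      (simp add: sgn_div_norm divide_inverse mult.commute)
  show dec: "v = norm v *\<^sub>R (cos (vangle w v) *\<^sub>R sgn w + sin (vangle w v) *\<^sub>R nbar v w)"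
    using s nz by (simp add: nbar_eq[OF assms] sgn_div_norm)
  show "sgn w \<bullet> nbar v w = 0"
    by (simp add: nbar_eq[OF assms] inner_diff_right w)
  have "nvec v w \<noteq> 0"
  proof
    assume "nvec v w = 0"
    then have "v = (norm v * cos (vangle w v) / norm w) *\<^sub>R w"
      using dec by (simp add: nbar_def sgn_div_norm divide_inverse mult.assoc)
    then obtain r where r: "v = r *\<^sub>R w" ..
    have "\<bar>w \<bullet> v\<bar> = norm w * norm v"
      unfolding r by (simp add: abs_mult power2_norm_eq_inner[symmetric] power2_eq_square)
    then show False using assms by (simp add: noncollinear_def)
  qed
  then show "norm (nbar v w) = 1" by (simp add: nbar_def norm_sgn)
qed

section \<open>Expectations of products of rectified linear forms\<close>

text \<open>The expression decreases to 0 at pi, its derivative being -(pi - x) sin x. The sign is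
  needed because \<open>ennreal\<close> sends negative reals to 0, so an \<open>ennreal\<close>
  value determines a real one only if that is nonnegative.\<close>

lemma sin_add_cos_nonneg:
  assumes "0 < \<theta>" "\<theta> < pi"
  shows "0 \<le> sin \<theta> + (pi - \<theta>) * cos \<theta>"
proof -
  have "sin pi + (pi - pi) * cos pi \<le> sin \<theta> + (pi - \<theta>) * cos \<theta>"
  proof (rule DERIV_nonpos_imp_nonincreasing[where f = "\<lambda>x. sin x + (pi - x) * cos x"])
    fix x assume "\<theta> \<le> x" "x \<le> pi"
    then have "- ((pi - x) * sin x) \<le> 0" using assms by (simp add: sin_ge_zero)
    moreover have "((\<lambda>x. sin x + (pi - x) * cos x) has_real_derivative - ((pi - x) * sin x)) (at x)"
      by (auto intro!: derivative_eq_intros)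
    ultimately show "\<exists>y. ((\<lambda>x. sin x + (pi - x) * cos x) has_real_derivative y) (at x) \<and> y \<le> 0" by blast
  qed (use assms in simp)
  then show ?thesis by simp
qed

lemma sets_std_gauss [measurable_cong, simp]: "sets std_gauss = sets borel"
  by (simp add: std_gauss_def)

text \<open>Up to here integrals are nonnegative and extended, so Fubini and substitutions need no
  integrability; the finite value now supplies it.\<close>

lemma has_bochner_integral_relu_relu:
  fixes w v :: "real^'k"
  assumes nc: "noncollinear w v"
  shows "has_bochner_integral std_gauss (\<lambda>x. relu (w \<bullet> x) * relu (v \<bullet> x)) (relu_kernel w v)"
proof -
  define \<theta> where "\<theta> = vangle w v"
  have \<theta>: "0 < \<theta>" "\<theta> < pi" using vangle_gt_zero[OF nc] vangle_lt_pi[OF nc] by (simp_all add: \<theta>_def)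
  note nz = noncollinear_nonzero[OF nc]
  define a where "a = sgn w"
  define b where "b = nbar v w"
  define G where "G y z = ennreal (relu y * relu (cos \<theta> * y + sin \<theta> * z))" for y z
  have ab: "norm a = 1" "norm b = 1" "a \<bullet> b = 0"
    using nz nbar_orthonormal[OF nc] by (simp_all add: a_def b_def norm_sgn)
  have w: "w = norm w *\<^sub>R a" using nz by (simp add: a_def sgn_div_norm)
  have v: "v = norm v *\<^sub>R (cos \<theta> *\<^sub>R a + sin \<theta> *\<^sub>R b)"
    using nbar_orthonormal(3)[OF nc] by (simp add: a_def b_def \<theta>_def)
  have "relu (w \<bullet> x) * relu (v \<bullet> x) =
      (norm w * norm v) * (relu (a \<bullet> x) * relu (cos \<theta> * (a \<bullet> x) + sin \<theta> * (b \<bullet> x)))" for x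
  proof -
    have "w \<bullet> x = norm w * (a \<bullet> x)" by (subst w) simp
    moreover have "v \<bullet> x = norm v * (cos \<theta> * (a \<bullet> x) + sin \<theta> * (b \<bullet> x))"
      by (subst v) (simp add: inner_add_left)
    ultimately show ?thesis by (simp add: relu_scale)
  qed
  then have "(\<integral>\<^sup>+x. ennreal (relu (w \<bullet> x) * relu (v \<bullet> x)) \<partial>std_gauss) =
      (\<integral>\<^sup>+x. ennreal (norm w * norm v) * G (a \<bullet> x) (b \<bullet> x) \<partial>std_gauss)"
    unfolding G_def by (simp add: ennreal_mult'[symmetric] relu_nonneg)
  also have "\<dots> = ennreal (norm w * norm v) * (\<integral>\<^sup>+x. G (a \<bullet> x) (b \<bullet> x) \<partial>std_gauss)"
    unfolding G_def by (rule nn_integral_cmult) measurable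
  also have "(\<integral>\<^sup>+x. G (a \<bullet> x) (b \<bullet> x) \<partial>std_gauss) = ennreal ((sin \<theta> + (pi - \<theta>) * cos \<theta>) / (2 * pi))"
    unfolding nn_integral_relu_relu_std_normal[OF \<theta>, symmetric] G_def
    by (rule nn_integral_std_gauss_orthonormal_pair[OF ab]) measurable
  also have "ennreal (norm w * norm v) * \<dots> = ennreal (norm w * norm v * ((sin \<theta> + (pi - \<theta>) * cos \<theta>) / (2 * pi)))"
    by (rule ennreal_mult'[symmetric]) simp
  also have eq: "norm w * norm v * ((sin \<theta> + (pi - \<theta>) * cos \<theta>) / (2 * pi)) = relu_kernel w v"
    using nz by (simp add: relu_kernel_def \<theta>_def sin_vangle[OF nc] cos_vangle[OF nc] distrib_left)
  finally show ?thesis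
    using sin_add_cos_nonneg[OF \<theta>]
    by (intro has_bochner_integral_nn_integral) (auto simp: relu_nonneg simp flip: eq)
qed

lemma noncollinear_iff_squares: "noncollinear w v \<longleftrightarrow> (w \<bullet> v)\<^sup>2 < (w \<bullet> w) * (v \<bullet> v)"
  unfolding noncollinear_def power2_norm_eq_inner[symmetric] power_mult_distrib[symmetric]
  using abs_le_square_iff[of "norm w * norm v" "w \<bullet> v"] by (auto simp: abs_mult not_le[symmetric])

text \<open>Negating \<open>v\<close> keeps the Gram root and replaces theta by pi - theta, so the
  coefficients pi - theta and theta of the inner product add up to pi.\<close>

lemma relu_kernel_minus_right:
  assumes "noncollinear w v"
  shows "relu_kernel w v - relu_kernel w (- v) = (w \<bullet> v) / 2"
proof -
  let ?c = "(w \<bullet> v) / (norm w * norm v)"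
  have "\<bar>?c\<bar> \<le> 1" using noncollinear_cosine[OF assms] by simp
  then have "-1 \<le> ?c" "?c \<le> 1" by linarith+
  then have "arccos (- ?c) = pi - arccos ?c" by (rule arccos_minus)
  then have \<theta>: "vangle w (- v) = pi - vangle w v" by (simp add: vangle_def)
  have g: "gram w (- v) = gram w v" by (simp add: gram_def)
  have "relu_kernel w v - relu_kernel w (- v) = (pi * (w \<bullet> v)) / (2 * pi)"
    unfolding relu_kernel_def \<theta> g inner_minus_right diff_divide_distrib[symmetric]
    by (simp add: algebra_simps)
  then show ?thesis by simp
qed

text \<open>A linear form is the difference of its positive and negative parts. Unlike the kernel,
  the resulting value is linear in \<open>v\<close>.\<close>

lemma has_bochner_integral_relu_linear:
  fixes w v :: "real^'k"
  assumes nc: "noncollinear w v"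
  shows "has_bochner_integral std_gauss (\<lambda>x. relu (w \<bullet> x) * (v \<bullet> x)) ((w \<bullet> v) / 2)"
proof -
  have "noncollinear w (- v)" using nc by (simp add: noncollinear_def)
  then have "has_bochner_integral std_gauss
      (\<lambda>x. relu (w \<bullet> x) * relu (v \<bullet> x) - relu (w \<bullet> x) * relu ((- v) \<bullet> x)) ((w \<bullet> v) / 2)"
    unfolding relu_kernel_minus_right[OF nc, symmetric]
    by (intro has_bochner_integral_diff has_bochner_integral_relu_relu nc)
  moreover have "relu (w \<bullet> x) * relu (v \<bullet> x) - relu (w \<bullet> x) * relu ((- v) \<bullet> x) = relu (w \<bullet> x) * (v \<bullet> x)" for x
    by (simp add: relu_def max_def)
  ultimately show ?thesis by simp
qed

text \<open>Writing \<open>w = (w + v) - v\<close> reduces the diagonal case to the noncollinear one.\<close>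

lemma has_bochner_integral_relu_square:
  fixes w v :: "real^'k"
  assumes nc: "noncollinear w v"
  shows "has_bochner_integral std_gauss (\<lambda>x. relu (w \<bullet> x) * relu (w \<bullet> x)) ((w \<bullet> w) / 2)"
proof -
  \<comment> \<open>Adding \<open>w\<close> to \<open>v\<close> is a shear and preserves the Gram
    determinant.\<close>
  have "noncollinear w (w + v)"
    using nc by (simp add: noncollinear_iff_squares inner_commute
        power2_eq_square algebra_simps)
  from has_bochner_integral_diff[OF has_bochner_integral_relu_linear[OF this] has_bochner_integral_relu_linear[OF nc]]
  have "has_bochner_integral std_gauss (\<lambda>x. relu (w \<bullet> x) * ((w + v) \<bullet> x) - relu (w \<bullet> x) * (v \<bullet> x)) ((w \<bullet> w) / 2)"
    by (simp add: inner_add_right diff_divide_distrib[symmetric])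
  moreover have "relu (w \<bullet> x) * ((w + v) \<bullet> x) - relu (w \<bullet> x) * (v \<bullet> x) = relu (w \<bullet> x) * relu (w \<bullet> x)" for x
    by (simp add: relu_def max_def algebra_simps)
  ultimately show ?thesis by simp
qed

lemma integrable_mult_of_squares:
  fixes f g :: "'a \<Rightarrow> real"
  assumes [measurable]: "f \<in> borel_measurable M" "g \<in> borel_measurable M"
    and "integrable M (\<lambda>x. f x * f x)" "integrable M (\<lambda>x. g x * g x)"
  shows "integrable M (\<lambda>x. f x * g x)"
proof (rule Bochner_Integration.integrable_bound)
  show "integrable M (\<lambda>x. f x * f x + g x * g x)" using assms by simp
  have "\<bar>a * b\<bar> \<le> a * a + b * b" for a b :: real
    using sum_squares_ge_zero[of "a - b" 0] sum_squares_ge_zero[of "a + b" 0]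
      sum_squares_ge_zero[of a b]
    by (simp add: abs_le_iff algebra_simps)
  then show "AE x in M. norm (f x * g x) \<le> norm (f x * f x + g x * g x)"
    by (auto intro: order_trans[OF _ abs_ge_self])
qed measurable

section \<open>The loss in closed form\<close>

text \<open>The region on which the closed form of the loss holds; pairs of targets are left
  unconstrained.\<close>

definition noncollinear_weights :: "('k::finite \<Rightarrow> real^'k) \<Rightarrow> real^'k^'n \<Rightarrow> bool" where
  "noncollinear_weights V U \<longleftrightarrow>
    (\<forall>i j. i \<noteq> j \<longrightarrow> noncollinear (U$i) (U$j)) \<and> (\<forall>i j. noncollinear (U$i) (V j))"

lemma lossF_eq:
  fixes V :: "'k::finite \<Rightarrow> real^'k" and U :: "real^'k^'n::finite"
  assumes nc: "noncollinear_weights V U"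
  shows "lossF V U =
    (1/2) * (\<Sum>i\<in>UNIV. (U$i \<bullet> U$i) / 2 + (\<Sum>l\<in>UNIV - {i}. relu_kernel (U$i) (U$l)))
    - (\<Sum>i\<in>UNIV. \<Sum>j\<in>UNIV. relu_kernel (U$i) (V j))
    + (1/2) * (\<Sum>j\<in>UNIV. \<Sum>l\<in>UNIV. \<integral>x. relu (V j \<bullet> x) * relu (V l \<bullet> x) \<partial>std_gauss)"
proof -
  have ncU: "noncollinear (U$i) (U$l)" if "i \<noteq> l" for i l
    using nc that by (simp add: noncollinear_weights_def)
  have ncV: "noncollinear (U$i) (V j)" for i j
    using nc by (simp add: noncollinear_weights_def)
  have UU: "has_bochner_integral std_gauss (\<lambda>x. \<Sum>i\<in>UNIV. \<Sum>l\<in>UNIV. relu (U$i \<bullet> x) * relu (U$l \<bullet> x))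
      (\<Sum>i\<in>UNIV. (U$i \<bullet> U$i) / 2 + (\<Sum>l\<in>UNIV - {i}. relu_kernel (U$i) (U$l)))"
  proof (intro has_bochner_integral_sum)
    fix i
    have "has_bochner_integral std_gauss
        (\<lambda>x. relu (U$i \<bullet> x) * relu (U$i \<bullet> x) + (\<Sum>l\<in>UNIV - {i}. relu (U$i \<bullet> x) * relu (U$l \<bullet> x)))
        ((U$i \<bullet> U$i) / 2 + (\<Sum>l\<in>UNIV - {i}. relu_kernel (U$i) (U$l)))"
      by (intro has_bochner_integral_add has_bochner_integral_sum has_bochner_integral_relu_relu
          has_bochner_integral_relu_square[OF ncV] ncU) auto
    then show "has_bochner_integral std_gauss (\<lambda>x. \<Sum>l\<in>UNIV. relu (U$i \<bullet> x) * relu (U$l \<bullet> x))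
        ((U$i \<bullet> U$i) / 2 + (\<Sum>l\<in>UNIV - {i}. relu_kernel (U$i) (U$l)))"
      by (subst sum.remove[of UNIV i]) simp_all
  qed
  have UV: "has_bochner_integral std_gauss (\<lambda>x. \<Sum>i\<in>UNIV. \<Sum>j\<in>UNIV. relu (U$i \<bullet> x) * relu (V j \<bullet> x))
      (\<Sum>i\<in>UNIV. \<Sum>j\<in>UNIV. relu_kernel (U$i) (V j))"
    by (intro has_bochner_integral_sum has_bochner_integral_relu_relu ncV)
  have sqV: "integrable std_gauss (\<lambda>x. relu (V j \<bullet> x) * relu (V j \<bullet> x))" for j
  proof -
    \<comment> \<open>The second moment of a target needs some vector noncollinear with it; any
      weight serves, and \<open>undefined\<close> is an arbitrary index.\<close>
    have "noncollinear (V j) (U$undefined)" using ncV[of undefined j] noncollinear_commute by blast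
    from has_bochner_integral_relu_square[OF this] show ?thesis by (rule integrable.intros)
  qed
  have VV': "integrable std_gauss (\<lambda>x. relu (V j \<bullet> x) * relu (V l \<bullet> x))" for j l
    by (rule integrable_mult_of_squares[OF _ _ sqV sqV]) measurable
  have VV: "has_bochner_integral std_gauss (\<lambda>x. \<Sum>j\<in>UNIV. \<Sum>l\<in>UNIV. relu (V j \<bullet> x) * relu (V l \<bullet> x))
      (\<Sum>j\<in>UNIV. \<Sum>l\<in>UNIV. \<integral>x. relu (V j \<bullet> x) * relu (V l \<bullet> x) \<partial>std_gauss)"
    by (intro has_bochner_integral_sum has_bochner_integral_integrable VV')
  have "(1/2) * ((\<Sum>i\<in>UNIV. relu (U$i \<bullet> x)) - (\<Sum>j\<in>UNIV. relu (V j \<bullet> x)))\<^sup>2 =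
      (1/2) * (\<Sum>i\<in>UNIV. \<Sum>l\<in>UNIV. relu (U$i \<bullet> x) * relu (U$l \<bullet> x))
      - (\<Sum>i\<in>UNIV. \<Sum>j\<in>UNIV. relu (U$i \<bullet> x) * relu (V j \<bullet> x))
      + (1/2) * (\<Sum>j\<in>UNIV. \<Sum>l\<in>UNIV. relu (V j \<bullet> x) * relu (V l \<bullet> x))" for x
    unfolding sum_product[symmetric] by (simp add: power2_eq_square algebra_simps)
  then show ?thesis
    unfolding lossF_def
    by (simp only:, intro has_bochner_integral_integral_eq has_bochner_integral_add has_bochner_integral_diff
        has_bochner_integral_mult_right UU UV VV)
qed

section \<open>First derivatives of the Gram root, the angle and the kernel\<close>

lemma has_derivative_gram:
  fixes p q :: "'b::real_normed_vector \<Rightarrow> 'a::real_inner"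
  assumes p: "(p has_derivative p') (at x)" and q: "(q has_derivative q') (at x)"
    and nc: "noncollinear (p x) (q x)"
  shows "((\<lambda>y. gram (p y) (q y)) has_derivative
    (\<lambda>h. ((p x \<bullet> p' h) * (q x \<bullet> q x) + (p x \<bullet> p x) * (q x \<bullet> q' h)
        - (p x \<bullet> q x) * (q x \<bullet> p' h + p x \<bullet> q' h)) / gram (p x) (q x))) (at x)"
proof -
  let ?r = "\<lambda>y. (p y \<bullet> p y) * (q y \<bullet> q y) - (p y \<bullet> q y)\<^sup>2"
  have r: "?r x > 0" using gram_pos[OF nc] unfolding gram_def by simp
  have r': "(?r has_derivative (\<lambda>h. 2 * ((p x \<bullet> p' h) * (q x \<bullet> q x) + (p x \<bullet> p x) * (q x \<bullet> q' h)
        - (p x \<bullet> q x) * (q x \<bullet> p' h + p x \<bullet> q' h)))) (at x)"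
    unfolding power2_eq_square
    by (rule derivative_eq_intros p q refl)+ (simp add: fun_eq_iff inner_commute algebra_simps)
  have "((\<lambda>y. sqrt (?r y)) has_derivative (\<lambda>h. 2 * ((p x \<bullet> p' h) * (q x \<bullet> q x) + (p x \<bullet> p x) * (q x \<bullet> q' h)
        - (p x \<bullet> q x) * (q x \<bullet> p' h + p x \<bullet> q' h)) * (inverse (sqrt (?r x)) / 2))) (at x)"
    by (rule DERIV_compose_FDERIV[OF DERIV_real_sqrt[OF r] r'])
  moreover have "2 * e * (inverse d / 2) = e / d" for e d :: real
    by (simp add: field_simps)
  ultimately show ?thesis unfolding gram_def by (simp only:)
qed

lemma has_derivative_vangle:
  fixes p q :: "'b::real_normed_vector \<Rightarrow> 'a::real_inner"
  assumes p: "(p has_derivative p') (at x)" and q: "(q has_derivative q') (at x)"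
    and nc: "noncollinear (p x) (q x)"
  shows "((\<lambda>y. vangle (p y) (q y)) has_derivative
    (\<lambda>h. - (q x \<bullet> p' h + p x \<bullet> q' h
        - (p x \<bullet> q x) * ((p x \<bullet> p' h) / (p x \<bullet> p x) + (q x \<bullet> q' h) / (q x \<bullet> q x))) / gram (p x) (q x))) (at x)"
proof -
  note nz = noncollinear_nonzero[OF nc]
  let ?N = "norm (p x) * norm (q x)"
  let ?c = "\<lambda>y. (p y \<bullet> q y) / (norm (p y) * norm (q y))"
  define c' where "c' h = (q x \<bullet> p' h + p x \<bullet> q' h
        - (p x \<bullet> q x) * ((p x \<bullet> p' h) / (p x \<bullet> p x) + (q x \<bullet> q' h) / (q x \<bullet> q x))) / ?N" for h
  have N: "?N > 0" using nz by simp
  \<comment> \<open>The derivative of the product of norms is written as the product times its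
    logarithmic derivative, so that the product cancels in the quotient rule.\<close>
  have "((\<lambda>y. norm (p y) * norm (q y)) has_derivative
      (\<lambda>h. ?N * ((p x \<bullet> p' h) / (p x \<bullet> p x) + (q x \<bullet> q' h) / (q x \<bullet> q x)))) (at x)"
  proof -
    have "((\<lambda>y. norm (p y) * norm (q y)) has_derivative
        (\<lambda>h. norm (p x) * (q' h \<bullet> sgn (q x)) + (p' h \<bullet> sgn (p x)) * norm (q x))) (at x)"
      using nz by (intro has_derivative_mult has_derivative_compose[OF p has_derivative_norm]
          has_derivative_compose[OF q has_derivative_norm])
    moreover have "norm (p x) * (q' h \<bullet> sgn (q x)) + (p' h \<bullet> sgn (p x)) * norm (q x) =
        ?N * ((p x \<bullet> p' h) / (p x \<bullet> p x) + (q x \<bullet> q' h) / (q x \<bullet> q x))" for h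
      using nz by (simp add: sgn_div_norm inner_commute field_simps power2_norm_eq_inner[symmetric] power2_eq_square)
    ultimately show ?thesis by simp
  qed
  from has_derivative_divide'[OF has_derivative_inner[OF p q] this]
  have "(?c has_derivative (\<lambda>h. ((p x \<bullet> q' h + p' h \<bullet> q x) * ?N
      - (p x \<bullet> q x) * (?N * ((p x \<bullet> p' h) / (p x \<bullet> p x) + (q x \<bullet> q' h) / (q x \<bullet> q x)))) / (?N * ?N))) (at x)"
    using nz by simp
  moreover have "((p x \<bullet> q' h + p' h \<bullet> q x) * ?N
      - (p x \<bullet> q x) * (?N * ((p x \<bullet> p' h) / (p x \<bullet> p x) + (q x \<bullet> q' h) / (q x \<bullet> q x)))) / (?N * ?N) = c' h" for h
  proof -
    have *: "(a * n - b * (n * d)) / (n * n) = (a - b * d) / n" if "n > 0" for a b d n :: real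
      using that by (simp add: field_simps)
    show ?thesis unfolding *[OF N] c'_def by (simp add: inner_commute add.commute)
  qed
  ultimately have c: "(?c has_derivative c') (at x)" by (simp only:)
  have "-1 < ?c x" "?c x < 1" using noncollinear_cosine[OF nc] unfolding abs_less_iff by linarith+
  from DERIV_compose_FDERIV[OF DERIV_arccos[OF this] c]
  have "((\<lambda>y. vangle (p y) (q y)) has_derivative (\<lambda>h. c' h * inverse (- sqrt (1 - (?c x)\<^sup>2)))) (at x)"
    by (simp only: vangle_def)
  \<comment> \<open>The derivative of \<open>arccos\<close> thus carries a factor \<open>?N\<close>,
    which cancels the denominator of \<open>c'\<close>.\<close>
  moreover have "sqrt (1 - (?c x)\<^sup>2) = gram (p x) (q x) / ?N"
    using sin_vangle[OF nc] noncollinear_cosine[OF nc] unfolding vangle_def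
    by (subst (asm) sin_arccos_abs) simp_all
  ultimately have "((\<lambda>y. vangle (p y) (q y)) has_derivative (\<lambda>h. c' h * inverse (- (gram (p x) (q x) / ?N)))) (at x)"
    by (simp only:)
  moreover have "c' h * inverse (- (gram (p x) (q x) / ?N)) = - (q x \<bullet> p' h + p x \<bullet> q' h
        - (p x \<bullet> q x) * ((p x \<bullet> p' h) / (p x \<bullet> p x) + (q x \<bullet> q' h) / (q x \<bullet> q x))) / gram (p x) (q x)" for h
  proof -
    have *: "e / n * inverse (- (g / n)) = - e / g" if "n > 0" for e n g :: real
      using that by (simp add: field_simps)
    show ?thesis unfolding c'_def *[OF N] ..
  qed
  ultimately show ?thesis by (simp only:)
qed

text \<open>The partial gradient of \<open>relu_kernel\<close> in its first argument. The
  coefficient of \<open>w\<close> is a disguised |v| sin theta / |w|, so the first summand is |v|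
  sin theta times the unit vector of \<open>w\<close>.\<close>

definition relu_grad :: "'a::real_inner \<Rightarrow> 'a \<Rightarrow> 'a" where
  "relu_grad w v = (1 / (2 * pi)) *\<^sub>R ((gram w v / (w \<bullet> w)) *\<^sub>R w + (pi - vangle w v) *\<^sub>R v)"

lemma has_derivative_relu_kernel:
  fixes p q :: "'b::real_normed_vector \<Rightarrow> 'a::real_inner"
  assumes p: "(p has_derivative p') (at x)" and q: "(q has_derivative q') (at x)"
    and nc: "noncollinear (p x) (q x)"
  shows "((\<lambda>y. relu_kernel (p y) (q y)) has_derivative
    (\<lambda>h. relu_grad (p x) (q x) \<bullet> p' h + relu_grad (q x) (p x) \<bullet> q' h)) (at x)"
proof -
  let ?w = "p x" and ?v = "q x"
  let ?D = "gram ?w ?v"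
  note nz = noncollinear_nonzero[OF nc]
  have nz': "?w \<bullet> ?w \<noteq> 0" "?v \<bullet> ?v \<noteq> 0" using nz by simp_all
  have D: "?D \<noteq> 0" using gram_pos[OF nc] by simp
  let ?dg = "\<lambda>h. ((?w \<bullet> p' h) * (?v \<bullet> ?v) + (?w \<bullet> ?w) * (?v \<bullet> q' h)
        - (?w \<bullet> ?v) * (?v \<bullet> p' h + ?w \<bullet> q' h)) / ?D"
  let ?da = "\<lambda>h. - (?v \<bullet> p' h + ?w \<bullet> q' h
        - (?w \<bullet> ?v) * ((?w \<bullet> p' h) / (?w \<bullet> ?w) + (?v \<bullet> q' h) / (?v \<bullet> ?v))) / ?D"
  have kernel: "relu_kernel (p y) (q y) =
      (1 / (2 * pi)) * (gram (p y) (q y) + (pi - vangle (p y) (q y)) * (p y \<bullet> q y))" for y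
    by (simp add: relu_kernel_def)
  have "((\<lambda>y. relu_kernel (p y) (q y)) has_derivative
      (\<lambda>h. (1 / (2 * pi)) * (?dg h + ((pi - vangle ?w ?v) * (?w \<bullet> q' h + p' h \<bullet> ?v) + (0 - ?da h) * (?w \<bullet> ?v))))) (at x)"
    unfolding kernel
    by (intro has_derivative_mult_right has_derivative_add has_derivative_mult has_derivative_diff
        has_derivative_const has_derivative_inner has_derivative_gram has_derivative_vangle p q nc)
  moreover have "(1 / (2 * pi)) * (?dg h + ((pi - vangle ?w ?v) * (?w \<bullet> q' h + p' h \<bullet> ?v) + (0 - ?da h) * (?w \<bullet> ?v))) =
      relu_grad ?w ?v \<bullet> p' h + relu_grad ?v ?w \<bullet> q' h" for h
  proof -
    \<comment> \<open>The reason the gradient is so simple: in the derivatives of the Gram root and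
      of the angle the mixed products cancel, and what remains is the Gram determinant over its
      root, times the logarithmic derivative of the product of norms.\<close>
    have "?dg h + (0 - ?da h) * (?w \<bullet> ?v) =
        ((?w \<bullet> ?w) * (?v \<bullet> ?v) - (?w \<bullet> ?v)\<^sup>2) / ?D * ((?w \<bullet> p' h) / (?w \<bullet> ?w) + (?v \<bullet> q' h) / (?v \<bullet> ?v))"
    proof -
      have *: "(a * V + W * b - c * (s + t)) / D + (0 - (- (s + t - c * (a / W + b / V)) / D)) * c =
          (W * V - c\<^sup>2) / D * (a / W + b / V)" if "W \<noteq> 0" "V \<noteq> 0" "D \<noteq> 0" for a b c s t W V D :: real
      proof -
        define e where "e = a / W + b / V"
        have "a * V + W * b = W * V * e"
          using that by (simp add: e_def distrib_left)
        then show ?thesis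
          unfolding e_def[symmetric]
          by (simp only:) (simp add: add_divide_distrib[symmetric] power2_eq_square algebra_simps)
      qed
      show ?thesis by (rule *[OF nz' D])
    qed
    also have "((?w \<bullet> ?w) * (?v \<bullet> ?v) - (?w \<bullet> ?v)\<^sup>2) / ?D = ?D"
      unfolding gram_squared[OF nc, symmetric] using D by (simp add: power2_eq_square)
    finally have k: "?dg h + (0 - ?da h) * (?w \<bullet> ?v) =
        ?D * ((?w \<bullet> p' h) / (?w \<bullet> ?w) + (?v \<bullet> q' h) / (?v \<bullet> ?v))" .
    have add_middle: "a + (m + b) = c + m" if "a + b = c" for a b c m :: real using that by simp
    have "?dg h + ((pi - vangle ?w ?v) * (?w \<bullet> q' h + p' h \<bullet> ?v) + (0 - ?da h) * (?w \<bullet> ?v)) =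
        ?D * ((?w \<bullet> p' h) / (?w \<bullet> ?w) + (?v \<bullet> q' h) / (?v \<bullet> ?v)) + (pi - vangle ?w ?v) * (?w \<bullet> q' h + p' h \<bullet> ?v)"
      by (rule add_middle[OF k])
    then show ?thesis
      unfolding relu_grad_def gram_commute[of ?v] vangle_commute[of ?v]
      by (simp only:) (simp add: inner_add_left inner_commute[of "p' h"] distrib_left add_divide_distrib)
  qed
  ultimately show ?thesis by (simp only:)
qed

section \<open>Second derivatives of the kernel and the blocks \<open>h1\<close> and
  \<open>h2\<close>\<close>

lemma outer_mult_vec: "outer u v *v x = (v \<bullet> x) *\<^sub>R u"
  by (simp add: vec_eq_iff matrix_vector_mult_def outer_def inner_vec_def sum_distrib_left algebra_simps)

lemma scaleR_mult_vec: "(c *\<^sub>R A) *v x = c *\<^sub>R (A *v x)" for A :: "real^'n^'m"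
  by (simp add: vec_eq_iff matrix_vector_mult_def sum_distrib_left mult.assoc)

text \<open>The component of \<open>v\<close> orthogonal to \<open>w\<close> has length
  \<open>gram w v / norm w\<close>, area over base.\<close>

lemma nbar_eq_gram:
  assumes nc: "noncollinear w v"
  shows "nbar v w = (norm w / gram w v) *\<^sub>R (v - ((w \<bullet> v) / (w \<bullet> w)) *\<^sub>R w)"
proof -
  note nz = noncollinear_nonzero[OF nc]
  have D: "gram w v \<noteq> 0" using gram_pos[OF nc] by simp
  have "nbar v w = (norm w * norm v / gram w v) *\<^sub>R ((1 / norm v) *\<^sub>R v - ((w \<bullet> v) / (norm w * norm v) / norm w) *\<^sub>R w)"
    by (simp add: nbar_eq[OF nc] sin_vangle[OF nc] cos_vangle[OF nc] sgn_div_norm inverse_eq_divide)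
  also have "\<dots> = (norm w / gram w v) *\<^sub>R (v - ((w \<bullet> v) / (norm w * norm w)) *\<^sub>R w)"
    using nz D by (simp add: scaleR_diff_right field_simps)
  also have "norm w * norm w = w \<bullet> w" by (simp add: power2_norm_eq_inner flip: power2_eq_square)
  finally show ?thesis .
qed

text \<open>Removes the trigonometry and the norms, so that \<open>h1\<close> can be compared with a
  derivative expressed in inner products and the Gram root.\<close>

lemma h1_mult_vec:
  assumes nc: "noncollinear w v"
  shows "h1 w v *v u = (1 / (2 * pi)) *\<^sub>R
    ((gram w v / (w \<bullet> w)) *\<^sub>R (u - ((w \<bullet> u) / (w \<bullet> w)) *\<^sub>R w)
      + ((v \<bullet> u - (w \<bullet> v) * (w \<bullet> u) / (w \<bullet> w)) / gram w v) *\<^sub>R (v - ((w \<bullet> v) / (w \<bullet> w)) *\<^sub>R w))"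
proof -
  note nz = noncollinear_nonzero[OF nc]
  have D: "gram w v \<noteq> 0" using gram_pos[OF nc] by simp
  define n where "n = v - ((w \<bullet> v) / (w \<bullet> w)) *\<^sub>R w"
  have nu: "n \<bullet> u = v \<bullet> u - (w \<bullet> v) * (w \<bullet> u) / (w \<bullet> w)"
    by (simp add: n_def inner_diff_left)
  have ww: "norm w * norm w = w \<bullet> w" by (simp add: power2_norm_eq_inner flip: power2_eq_square)
  have c: "sin (vangle w v) * norm v / (2 * pi * norm w) = (1 / (2 * pi)) * (gram w v / (w \<bullet> w))"
    using nz by (simp add: sin_vangle[OF nc] flip: ww)
  have s: "(sgn w \<bullet> u) *\<^sub>R sgn w = ((w \<bullet> u) / (w \<bullet> w)) *\<^sub>R w"
    by (simp add: sgn_div_norm divide_inverse flip: ww)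
  have "(nbar v w \<bullet> u) *\<^sub>R nbar v w = ((norm w * norm w) * (n \<bullet> u) / (gram w v)\<^sup>2) *\<^sub>R n"
    unfolding nbar_eq_gram[OF nc] n_def[symmetric] by (simp add: power2_eq_square)
  then have b: "(nbar v w \<bullet> u) *\<^sub>R nbar v w = ((w \<bullet> w) * (n \<bullet> u) / (gram w v)\<^sup>2) *\<^sub>R n"
    by (simp only: ww)
  have "h1 w v *v u = ((1 / (2 * pi)) * (gram w v / (w \<bullet> w))) *\<^sub>R
      (u - ((w \<bullet> u) / (w \<bullet> w)) *\<^sub>R w + ((w \<bullet> w) * (n \<bullet> u) / (gram w v)\<^sup>2) *\<^sub>R n)"
    unfolding h1_def scaleR_mult_vec c matrix_vector_mult_add_rdistrib matrix_vector_mult_diff_rdistrib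
      outer_mult_vec matrix_vector_mul_lid s b ..
  also have "\<dots> = (1 / (2 * pi)) *\<^sub>R ((gram w v / (w \<bullet> w)) *\<^sub>R (u - ((w \<bullet> u) / (w \<bullet> w)) *\<^sub>R w)
      + ((gram w v / (w \<bullet> w)) * ((w \<bullet> w) * (n \<bullet> u) / (gram w v)\<^sup>2)) *\<^sub>R n)"
    by (simp only: scaleR_add_right scaleR_scaleR mult.assoc)
  also have "(gram w v / (w \<bullet> w)) * ((w \<bullet> w) * (n \<bullet> u) / (gram w v)\<^sup>2) = (n \<bullet> u) / gram w v"
    using D nz by (simp add: power2_eq_square)
  finally show ?thesis unfolding nu unfolding n_def .
qed

lemma h2_mult_vec:
  assumes nc: "noncollinear w v"
  shows "h2 w v *v u = (1 / (2 * pi)) *\<^sub>R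
    ((pi - vangle w v) *\<^sub>R u + ((v \<bullet> u) / gram w v) *\<^sub>R (w - ((w \<bullet> v) / (v \<bullet> v)) *\<^sub>R v)
      + ((w \<bullet> u) / gram w v) *\<^sub>R (v - ((w \<bullet> v) / (w \<bullet> w)) *\<^sub>R w))"
proof -
  have nc': "noncollinear v w" using nc noncollinear_commute by blast
  have *: "(sgn w \<bullet> u) *\<^sub>R nbar v w = ((w \<bullet> u) / gram w v) *\<^sub>R (v - ((w \<bullet> v) / (w \<bullet> w)) *\<^sub>R w)"
    if "noncollinear w v" for w v :: "real^'a"
    using noncollinear_nonzero[OF that] by (simp add: nbar_eq_gram[OF that] sgn_div_norm)
  show ?thesis
    unfolding h2_def scaleR_mult_vec matrix_vector_mult_add_rdistrib outer_mult_vec matrix_vector_mul_lid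
      *[OF nc] *[OF nc'] gram_commute[of v w] inner_commute[of v w] ..
qed

text \<open>Both sides are combinations of \<open>p' h\<close>, \<open>q' h\<close>,
  \<open>p x\<close> and \<open>q x\<close>. The first two coefficients agree at sight; those of
  \<open>p x\<close> and \<open>q x\<close> are the scalar identities \<open>\<beta>\<close> and
  \<open>\<delta>\<close> below.\<close>

lemma has_derivative_relu_grad:
  fixes p q :: "'b::real_normed_vector \<Rightarrow> real^'k"
  assumes p: "(p has_derivative p') (at x)" and q: "(q has_derivative q') (at x)"
    and nc: "noncollinear (p x) (q x)"
  shows "((\<lambda>y. relu_grad (p y) (q y)) has_derivative
    (\<lambda>h. h1 (p x) (q x) *v p' h + h2 (p x) (q x) *v q' h)) (at x)"
proof -
  let ?w = "p x" and ?v = "q x"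
  let ?D = "gram ?w ?v"
  note nz = noncollinear_nonzero[OF nc]
  have W: "?w \<bullet> ?w \<noteq> 0" and V: "?v \<bullet> ?v \<noteq> 0" using nz by simp_all
  have D: "?D \<noteq> 0" using gram_pos[OF nc] by simp
  let ?dg = "\<lambda>h. ((?w \<bullet> p' h) * (?v \<bullet> ?v) + (?w \<bullet> ?w) * (?v \<bullet> q' h)
        - (?w \<bullet> ?v) * (?v \<bullet> p' h + ?w \<bullet> q' h)) / ?D"
  let ?da = "\<lambda>h. - (?v \<bullet> p' h + ?w \<bullet> q' h
        - (?w \<bullet> ?v) * ((?w \<bullet> p' h) / (?w \<bullet> ?w) + (?v \<bullet> q' h) / (?v \<bullet> ?v))) / ?D"
  let ?\<beta> = "\<lambda>h. (?dg h * (?w \<bullet> ?w) - ?D * (?w \<bullet> p' h + p' h \<bullet> ?w)) / ((?w \<bullet> ?w) * (?w \<bullet> ?w))"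
  have "((\<lambda>y. relu_grad (p y) (q y)) has_derivative
      (\<lambda>h. (1 / (2 * pi)) *\<^sub>R (((?D / (?w \<bullet> ?w)) *\<^sub>R p' h + ?\<beta> h *\<^sub>R ?w)
        + ((pi - vangle ?w ?v) *\<^sub>R q' h + (0 - ?da h) *\<^sub>R ?v)))) (at x)"
    unfolding relu_grad_def
    by (intro has_derivative_scaleR_right has_derivative_add has_derivative_scaleR has_derivative_diff
        has_derivative_divide' has_derivative_const has_derivative_inner has_derivative_gram
        has_derivative_vangle p q nc W)
  moreover have "(1 / (2 * pi)) *\<^sub>R (((?D / (?w \<bullet> ?w)) *\<^sub>R p' h + ?\<beta> h *\<^sub>R ?w)
        + ((pi - vangle ?w ?v) *\<^sub>R q' h + (0 - ?da h) *\<^sub>R ?v)) =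
      h1 ?w ?v *v p' h + h2 ?w ?v *v q' h" for h
  proof -
    define a b s t c W V where defs: "a = ?w \<bullet> p' h" "b = ?v \<bullet> q' h" "s = ?v \<bullet> p' h" "t = ?w \<bullet> q' h"
      "c = ?w \<bullet> ?v" "W = ?w \<bullet> ?w" "V = ?v \<bullet> ?v"
    have D2: "?D * ?D = W * V - c * c"
      using gram_squared[OF nc] by (simp add: defs power2_eq_square)
    have nzs: "W \<noteq> 0" "V \<noteq> 0" using nz by (simp_all add: defs)
    \<comment> \<open>On the right, the terms with b and t come from \<open>h2\<close>, the other
      two from \<open>h1\<close>. The identity needs the relation between the Gram root and the
      inner products, used by eliminating \<open>V\<close>.\<close>
    have \<beta>: "(((a * V + W * b - c * (s + t)) / ?D) * W - ?D * (a + a)) / (W * W) =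
        b / ?D - (?D / W * (a / W) + (s - c * a / W) / ?D * (c / W) + t / ?D * (c / W))"
    proof -
      have "V = (?D * ?D + c * c) / W" using D2 nzs by simp
      then show ?thesis using D nzs(1) by (simp only:) (simp add: field_simps)
    qed
    have \<delta>: "0 - (- (s + t - c * (a / W + b / V)) / ?D) = (s - c * a / W) / ?D + (t / ?D - b / ?D * (c / V))"
      using D nzs by (simp add: field_simps)
    have comm: "p' h \<bullet> ?w = a" by (simp add: defs inner_commute)
    show ?thesis
      unfolding h1_mult_vec[OF nc] h2_mult_vec[OF nc] comm defs[symmetric] \<beta> \<delta>
      by (simp only: scaleR_add_right[symmetric])
        (simp add: scaleR_add_left scaleR_diff_left scaleR_add_right scaleR_diff_right)
  qed
  ultimately show ?thesis by (simp only:)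
qed

section \<open>Gradient and Hessian of the loss\<close>

lemma has_derivative_vec_lambda:
  fixes f :: "'n::finite \<Rightarrow> 'b::real_normed_vector \<Rightarrow> 'a::euclidean_space"
  assumes "\<And>i. (f i has_derivative f' i) (at x)"
  shows "((\<lambda>y. \<chi> i. f i y) has_derivative (\<lambda>h. \<chi> i. f' i h)) (at x)"
proof -
  have axis: "bounded_linear (axis i :: 'a \<Rightarrow> 'a^'n)" for i
    unfolding linear_conv_bounded_linear[symmetric]
    by (rule linearI) (auto simp: axis_def vec_eq_iff)
  have sum: "(\<chi> i. g i) = (\<Sum>i\<in>UNIV. axis i (g i))" for g :: "'n \<Rightarrow> 'a"
    by (simp add: vec_eq_iff axis_def if_distrib[where f="\<lambda>x. x $ _"] cong: if_cong)
  show ?thesis unfolding sum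
    by (intro has_derivative_sum bounded_linear.has_derivative[OF axis] assms)
qed

lemma open_noncollinear_weights:
  fixes V :: "'k::finite \<Rightarrow> real^'k"
  shows "open {U :: real^'k^'n::finite. noncollinear_weights V U}"
proof -
  have "open {U :: real^'k^'n. noncollinear (U$i) (U$j)}" "open {U :: real^'k^'n. noncollinear (U$i) (V l)}" for i j l
    unfolding noncollinear_def by (intro open_Collect_less continuous_intros)+
  moreover have "open {U :: real^'k^'n. i \<noteq> j \<longrightarrow> noncollinear (U$i) (U$j)}" for i j
    using calculation(1)[of i j] by (cases "i = j") simp_all
  ultimately show ?thesis
    unfolding noncollinear_weights_def Collect_conj_eq Collect_all_eq
    by (intro open_Int open_INT ballI finite) simp_all
qed

text \<open>The factor 1/2 before the sum over pairs of weights disappears because each unordered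
  pair occurs twice; the one before \<open>U$i\<close> remains from (1/4) |w|^2.\<close>

definition loss_grad :: "('k::finite \<Rightarrow> real^'k) \<Rightarrow> real^'k^'n::finite \<Rightarrow> real^'k^'n" where
  "loss_grad V U = (\<chi> i. (1/2) *\<^sub>R U$i + (\<Sum>l\<in>UNIV - {i}. relu_grad (U$i) (U$l))
    - (\<Sum>j\<in>UNIV. relu_grad (U$i) (V j)))"

lemma has_derivative_lossF:
  fixes V :: "'k::finite \<Rightarrow> real^'k" and U :: "real^'k^'n::finite"
  assumes nc: "noncollinear_weights V U"
  shows "(lossF V has_derivative (\<lambda>H. loss_grad V U \<bullet> H)) (at U)"
proof -
  have ncU: "noncollinear (U$i) (U$l)" if "l \<in> UNIV - {i}" for i l
    using nc that by (simp add: noncollinear_weights_def)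
  have ncV: "noncollinear (U$i) (V j)" for i j
    using nc by (simp add: noncollinear_weights_def)
  have nth: "((\<lambda>y::real^'k^'n. y$i) has_derivative (\<lambda>H. H$i)) (at U)" for i
    by (rule bounded_linear_imp_has_derivative) (rule bounded_linear_vec_nth)
  have "((\<lambda>U. (1/2) * (\<Sum>i\<in>UNIV. (U$i \<bullet> U$i) * (1/2) + (\<Sum>l\<in>UNIV - {i}. relu_kernel (U$i) (U$l)))
      - (\<Sum>i\<in>UNIV. \<Sum>j\<in>UNIV. relu_kernel (U$i) (V j))
      + (1/2) * (\<Sum>j\<in>UNIV. \<Sum>l\<in>UNIV. \<integral>x. relu (V j \<bullet> x) * relu (V l \<bullet> x) \<partial>std_gauss))
    has_derivative
     (\<lambda>H. (1/2) * (\<Sum>i\<in>UNIV. (U$i \<bullet> H$i + H$i \<bullet> U$i) * (1/2)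
          + (\<Sum>l\<in>UNIV - {i}. relu_grad (U$i) (U$l) \<bullet> H$i + relu_grad (U$l) (U$i) \<bullet> H$l))
      - (\<Sum>i\<in>UNIV. \<Sum>j\<in>UNIV. relu_grad (U$i) (V j) \<bullet> H$i + relu_grad (V j) (U$i) \<bullet> 0) + 0)) (at U)"
    by (intro has_derivative_add has_derivative_diff has_derivative_mult_right has_derivative_sum
        has_derivative_mult_left has_derivative_inner has_derivative_relu_kernel nth has_derivative_const ncU ncV)
  \<comment> \<open>The closed form equals the loss only on an open set around \<open>U\<close>,
    which is enough for the derivative.\<close>
  from has_derivative_transform_within_open[OF this open_noncollinear_weights[of V], of "lossF V"]
  have "(lossF V has_derivative
     (\<lambda>H. (1/2) * (\<Sum>i\<in>UNIV. (U$i \<bullet> H$i + H$i \<bullet> U$i) * (1/2)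
          + (\<Sum>l\<in>UNIV - {i}. relu_grad (U$i) (U$l) \<bullet> H$i + relu_grad (U$l) (U$i) \<bullet> H$l))
      - (\<Sum>i\<in>UNIV. \<Sum>j\<in>UNIV. relu_grad (U$i) (V j) \<bullet> H$i + relu_grad (V j) (U$i) \<bullet> 0) + 0)) (at U)"
    using nc by (simp add: lossF_eq)
  moreover have "(1/2) * (\<Sum>i\<in>UNIV. (U$i \<bullet> H$i + H$i \<bullet> U$i) * (1/2)
          + (\<Sum>l\<in>UNIV - {i}. relu_grad (U$i) (U$l) \<bullet> H$i + relu_grad (U$l) (U$i) \<bullet> H$l))
      - (\<Sum>i\<in>UNIV. \<Sum>j\<in>UNIV. relu_grad (U$i) (V j) \<bullet> H$i + relu_grad (V j) (U$i) \<bullet> 0) + 0 =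
      loss_grad V U \<bullet> H" for H
  proof -
    define S where "S = (\<Sum>i\<in>UNIV. \<Sum>l\<in>UNIV - {i}. relu_grad (U$i) (U$l) \<bullet> H$i)"
    define T where "T = (\<Sum>i\<in>UNIV. U$i \<bullet> H$i)"
    define R where "R = (\<Sum>i\<in>UNIV. \<Sum>j\<in>UNIV. relu_grad (U$i) (V j) \<bullet> H$i)"
    \<comment> \<open>Summing over all indices, with 0 on the diagonal, makes the inner range
      independent of \<open>i\<close>, so the two sums can be exchanged.\<close>
    have off_diagonal: "(\<Sum>l\<in>UNIV - {i}. f l) = (\<Sum>l\<in>UNIV. if l = i then 0 else f l)" for i :: 'n and f :: "'n \<Rightarrow> real"
      by (rule sum.mono_neutral_cong_left) auto
    have sym: "(\<Sum>i\<in>UNIV. \<Sum>l\<in>UNIV - {i}. relu_grad (U$l) (U$i) \<bullet> H$l) = S"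
      unfolding S_def off_diagonal by (subst sum.swap) (intro sum.cong refl, auto)
    have "(\<Sum>i\<in>UNIV. (U$i \<bullet> H$i + H$i \<bullet> U$i) * (1/2)
          + (\<Sum>l\<in>UNIV - {i}. relu_grad (U$i) (U$l) \<bullet> H$i + relu_grad (U$l) (U$i) \<bullet> H$l)) = T + (S + S)"
      by (simp add: sum.distrib sym) (simp add: S_def T_def inner_commute)
    moreover have "(\<Sum>i\<in>UNIV. \<Sum>j\<in>UNIV. relu_grad (U$i) (V j) \<bullet> H$i + relu_grad (V j) (U$i) \<bullet> 0) = R"
      by (simp add: R_def)
    moreover have "loss_grad V U \<bullet> H = (1/2) * T + S - R"
      unfolding inner_vec_def[of "loss_grad V U"]
      by (simp add: loss_grad_def inner_add_left inner_diff_left inner_sum_left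
          sum.distrib sum_subtractf S_def T_def R_def sum_divide_distrib)
    ultimately show ?thesis by (simp add: distrib_left)
  qed
  ultimately show ?thesis by (simp only:)
qed

lemma has_derivative_loss_grad:
  fixes V :: "'k::finite \<Rightarrow> real^'k" and U :: "real^'k^'n::finite"
  assumes nc: "noncollinear_weights V U"
  shows "(loss_grad V has_derivative (\<lambda>H. \<chi> i. \<Sum>j\<in>UNIV. hess_block V U i j *v H$j)) (at U)"
proof -
  have ncU: "noncollinear (U$i) (U$l)" if "l \<in> UNIV - {i}" for i l
    using nc that by (simp add: noncollinear_weights_def)
  have ncV: "noncollinear (U$i) (V j)" for i j
    using nc by (simp add: noncollinear_weights_def)
  have nth: "((\<lambda>y::real^'k^'n. y$i) has_derivative (\<lambda>H. H$i)) (at U)" for i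
    by (rule bounded_linear_imp_has_derivative) (rule bounded_linear_vec_nth)
  \<comment> \<open>The targets are constant, so their direction is 0 and only \<open>h1\<close>
    survives in their terms.\<close>
  have "(loss_grad V has_derivative (\<lambda>H. \<chi> i. (1/2) *\<^sub>R H$i
      + (\<Sum>l\<in>UNIV - {i}. h1 (U$i) (U$l) *v H$i + h2 (U$i) (U$l) *v H$l)
      - (\<Sum>j\<in>UNIV. h1 (U$i) (V j) *v H$i + h2 (U$i) (V j) *v 0))) (at U)"
    unfolding loss_grad_def[abs_def]
    by (intro has_derivative_vec_lambda has_derivative_add has_derivative_diff has_derivative_sum
        has_derivative_scaleR_right has_derivative_relu_grad nth has_derivative_const ncU ncV)
  moreover have "(1/2) *\<^sub>R H$i
      + (\<Sum>l\<in>UNIV - {i}. h1 (U$i) (U$l) *v H$i + h2 (U$i) (U$l) *v H$l)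
      - (\<Sum>j\<in>UNIV. h1 (U$i) (V j) *v H$i + h2 (U$i) (V j) *v 0) =
      (\<Sum>j\<in>UNIV. hess_block V U i j *v H$j)" for H :: "real^'k^'n" and i
  proof -
    have sum_mult: "sum f A *v y = (\<Sum>l\<in>A. f l *v y)" if "finite A" for f :: "'c \<Rightarrow> real^'k^'k" and A y
      using that by induction (simp_all add: matrix_vector_mult_add_rdistrib)
    have "(\<Sum>j\<in>UNIV. hess_block V U i j *v H$j) =
        hess_block V U i i *v H$i + (\<Sum>j\<in>UNIV - {i}. hess_block V U i j *v H$j)"
      by (rule sum.remove) simp_all
    also have "(\<Sum>j\<in>UNIV - {i}. hess_block V U i j *v H$j) = (\<Sum>j\<in>UNIV - {i}. h2 (U$i) (U$j) *v H$j)"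
      by (intro sum.cong refl) (auto simp: hess_block_def)
    also have "hess_block V U i i *v H$i = (1/2) *\<^sub>R H$i + (\<Sum>l\<in>UNIV - {i}. h1 (U$i) (U$l) *v H$i)
        - (\<Sum>j\<in>UNIV. h1 (U$i) (V j) *v H$i)"
      by (simp add: hess_block_def matrix_vector_mult_add_rdistrib matrix_vector_mult_diff_rdistrib
          scaleR_mult_vec sum_mult)
    finally show ?thesis by (simp add: sum.distrib)
  qed
  ultimately show ?thesis by (simp only:)
qed

text \<open>The Hessian appears as the Frechet derivative at \<open>W\<close> of a map that is the
  gradient on a whole neighbourhood of \<open>W\<close>; this is stronger than the existence of the
  second partial derivatives.\<close>

theorem theorem5:
  fixes V :: "'k::finite \<Rightarrow> real^'k" and W :: "real^'k^'n::finite"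
  assumes "\<forall>i. W$i \<noteq> 0" and "\<forall>j. V j \<noteq> 0"
    and "\<forall>i j. i \<noteq> j \<longrightarrow> vangle (W$i) (W$j) \<in> {0<..<pi}"
    and "\<forall>i j. vangle (W$i) (V j) \<in> {0<..<pi}"
  shows "\<exists>G :: real^'k^'n \<Rightarrow> real^'k^'n.
           (\<forall>\<^sub>F U in nhds W. (lossF V has_derivative (\<lambda>H. G U \<bullet> H)) (at U)) \<and>
           (G has_derivative (\<lambda>H. \<chi> i. \<Sum>j\<in>UNIV. hess_block V W i j *v H$j)) (at W)"
proof -
  have nc: "noncollinear_weights V W"
    using assms by (auto simp: noncollinear_weights_def intro: noncollinearI)
  have "\<forall>\<^sub>F U in nhds W. noncollinear_weights V U"
    using eventually_nhds_in_open[OF open_noncollinear_weights[of V], of W] nc by simp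
  then have "\<forall>\<^sub>F U in nhds W. (lossF V has_derivative (\<lambda>H. loss_grad V U \<bullet> H)) (at U)"
    by (rule eventually_mono) (rule has_derivative_lossF)
  with has_derivative_loss_grad[OF nc] show ?thesis by blast
qed

end
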